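(* Let $\mathcal V$ be a Poisson vertex algebra, consider the corresponding Lie conformal algebroid $\Omega(\mathcal V)$ of Kähler differentials over $\mathcal V$, and let $M$ be a left $\mathcal V[\partial]$-module. There is a bijective correspondence between: (a) the $\lambda$-actions of $\mathcal V$ on $M$ making $M$ a PVA module over $\mathcal V$; (b) the $\lambda$-actions of $\Omega(\mathcal V)$ on $M$ making $M$ an LCAd module over $\Omega(\mathcal V)$. This correspondence associates to a PVA $\lambda$-action $f_\lambda m$ of $\mathcal V$ on $M$ the LCAd $\lambda$-action of $\Omega(\mathcal V)$ on $M$ given by $$(f\,dg)_\lambda m=\big(\big|_{x=\partial}f\big)\cdot(g_{\lambda+x}m)\qquad(f,g\in\mathcal V,\ m\in M).$$
   Context: Everything is over a field $\mathbb F$ of characteristic $0$. A differential algebra $A$ is a commutative associative unital algebra with a derivation $\partial$; $A[\partial]$ is the associative algebra of differential operators $a(\partial)=\sum_i a_i\partial^i$ (product = composition), with symbol $a(x)=\sum_ia_ix^i$ and adjoint symbol $a^*(\lambda)=\sum_i(-\lambda-\partial)^i(a_i)\in A[\lambda]$. Substitution convention: in an expression containing a factor $\big(\big|_{x=\partial}f\big)$, expand the whole expression in powers of the commuting indeterminate $x$ and replace each $x^n$ by $\partial^n$ acting only on what is inside that parenthesis (on coefficients, if $f$ is a polynomial). E.g. $a(\lambda+x)\big(\big|_{x=\partial}b\big)c=c\sum_ia_i(\lambda+\partial)^i(b)$. For $\theta_\lambda$ linear, $\theta_\lambda(a(x))=\sum_i\theta_\lambda(a_i)x^i$. $\mathrm{CDer}(A)$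 is the space of linear maps $\phi_\lambda:A\to A[\lambda]$ with $\phi_\lambda(\partial a)=(\partial+\lambda)\phi_\lambda(a)$ and $\phi_\lambda(ab)=\phi_\lambda(a)b+a\phi_\lambda(b)$; it is a left $A[\partial]$-module by $(a(\partial)\phi)_\lambda=\big(\big|_{x=\partial}a^*(\lambda)\big)\phi_{\lambda+x}$. A Lie conformal algebra (LCA) is an $\mathbb F[\partial]$-module $E$ with a bilinear $\lambda$-bracket $[\cdot_\lambda\cdot]:E\otimes E\to E[\lambda]$ with: $[\partial u_\lambda v]=-\lambda[u_\lambda v]$, $[u_\lambda\partial v]=(\partial+\lambda)[u_\lambda v]$; $[v_\lambda u]=-\big(\big|_{x=\partial}[u_{-\lambda-x}v]\big)$; $[u_\lambda[v_\mu w]]-[v_\mu[u_\lambda w]]=[[u_\lambda v]_{\lambda+\mu}w]$. A Lie conformal algebroid (LCAd) over $A$ is a left $A[\partial]$-module $E$ with a left $A[\partial]$-module homomorphism $\theta:E\to\mathrm{CDer}(A)$ (anchor) and an LCA $\lambda$-bracket such that (i) $[u_\lambda a(\partial)v]=a(\lambda+x)\big(\big|_{x=\partial}[u_\lambda v]\big)+\theta(u)_\lambda(a(x))\big(\big|_{x=\partial}v\big)$, and (ii) $\theta([u_\lambda v])_\mu(a)=\theta(u)_\lambda(\theta(v)_{\mu-\lambda}(a))-\theta(v)_{\mu-\lambda}(\theta(u)_\lambda(a))$. A module over the LCAd $E$ is a left $A[\partial]$-module $M$ with a bilinear $\lambda$-action $E\times M\to M[\lambda]$, $(u,m)\mapsto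 u_\lambda m$, such that (i) $u_\lambda(a(\partial)m)=a(\lambda+x)\big(\big|_{x=\partial}u_\lambda m\big)+\theta(u)_\lambda(a(x))\big(\big|_{x=\partial}m\big)$; (ii) $(a(\partial)u)_\lambda m=\big(\big|_{x=\partial}a^*(\lambda)\big)(u_{\lambda+x}m)$; (iii) $[u_\lambda v]_\mu m=u_\lambda(v_{\mu-\lambda}m)-v_{\mu-\lambda}(u_\lambda m)$. A Poisson vertex algebra (PVA) is a differential algebra $\mathcal V$ with an LCA $\lambda$-bracket $\{\cdot_\lambda\cdot\}$ on the $\mathbb F[\partial]$-module $\mathcal V$ satisfying $\{f_\lambda gh\}=g\{f_\lambda h\}+h\{f_\lambda g\}$. A left $\mathcal V[\partial]$-module $M$ (action of $f\in\mathcal V$ denoted $f\cdot m$) with a bilinear $\lambda$-action $f_\lambda m\in M[\lambda]$ is a PVA module over $\mathcal V$ if $(\partial f)_\lambda m=-\lambda f_\lambda m$, $f_\lambda(\partial m)=(\partial+\lambda)(f_\lambda m)$, $f_\lambda(g_\mu m)-g_\mu(f_\lambda m)=\{f_\lambda g\}_{\lambda+\mu}m$, $f_\lambda(g\cdot m)=\{f_\lambda g\}\cdot m+g\cdot(f_\lambda m)$ and $(fg)_\lambda m=\big(\big|_{x=\partial}f\big)\cdot(g_{\lambda+x}m)+\big(\big|_{x=\partial}g\big)\cdot(f_{\lambda+x}m)$. $\Omega(\mathcal V)$ is the $\mathcal V$-module generated by symbols $df$, $f\in\mathcal V$, modulo linearity of $d$ and $d(fg)=fdg+gdf$, with $\partial(fdg)=(\partial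 f)dg+fd(\partial g)$. It is an LCAd over $\mathcal V$: the anchor is the left $\mathcal V[\partial]$-module homomorphism with $\theta(df)_\lambda(g)=\{f_\lambda g\}$, and the $\lambda$-bracket is the unique LCAd $\lambda$-bracket with $[df_\lambda dg]=d(\{f_\lambda g\})$ ($d$ acting on coefficients). *)

theory Defs
  imports "HOL-Computational_Algebra.Polynomial" "HOL-Library.Poly_Mapping"
begin

section \<open>Substitutions in polynomials with module coefficients\<close>

text \<open>
  A polynomial in \<open>\<lambda>\<close> with coefficients in an additive group \<open>E\<close> is an element of
  \<open>'e poly\<close>. A polynomial in \<open>\<lambda>\<close> and \<open>\<mu>\<close> is an element of \<open>'e poly poly\<close>, where the
  outer variable is \<open>\<lambda>\<close> and the inner variable is \<open>\<mu>\<close>. Variables, and sums of variables and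
  \<open>\<partial>\<close>, are represented by the (commuting) operators of multiplication by them.
\<close>

text \<open>
  \<open>psubst T emb p\<close> is \<open>\<Sum>\<^sub>i T\<^sup>i (p\<^sub>i)\<close>: the variable of \<open>p\<close> is replaced by the operator \<open>T\<close>,
  and \<open>emb\<close> maps the coefficients to the space on which \<open>T\<close> acts.
\<close>

definition psubst :: "('b::comm_monoid_add \<Rightarrow> 'b) \<Rightarrow> ('e::zero \<Rightarrow> 'b) \<Rightarrow> 'e poly \<Rightarrow> 'b" where
  "psubst T emb p = (\<Sum>i\<le>degree p. (T ^^ i) (emb (coeff p i)))"

definition const1 :: "'e::zero \<Rightarrow> 'e poly" where
  "const1 c = [:c:]"

definition const2 :: "'e::zero \<Rightarrow> 'e poly poly" where
  "const2 c = [:[:c:]:]"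

text \<open>The operators \<open>\<lambda> + \<partial>\<close> and \<open>-\<lambda> - \<partial>\<close>, with \<open>\<partial>\<close> (here \<open>D\<close>) acting on coefficients.\<close>

definition lam_plus :: "('e \<Rightarrow> 'e) \<Rightarrow> 'e::ab_group_add poly \<Rightarrow> 'e poly" where
  "lam_plus D p = pCons 0 p + map_poly D p"

definition neg_lam_plus :: "('e \<Rightarrow> 'e) \<Rightarrow> 'e::ab_group_add poly \<Rightarrow> 'e poly" where
  "neg_lam_plus D p = - lam_plus D p"

definition lam :: "'e::ab_group_add poly poly \<Rightarrow> 'e poly poly" where
  "lam P = pCons 0 P"

definition mu :: "'e::ab_group_add poly poly \<Rightarrow> 'e poly poly" where
  "mu P = map_poly (pCons 0) P"

definition lam_plus_mu :: "'e::ab_group_add poly poly \<Rightarrow> 'e poly poly" where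
  "lam_plus_mu P = lam P + mu P"

definition mu_minus_lam :: "'e::ab_group_add poly poly \<Rightarrow> 'e poly poly" where
  "mu_minus_lam P = mu P - lam P"

text \<open>
  \<open>psubst2 S f T p\<close>: apply the map \<open>f\<^sub>S\<close> (\<open>f\<close> with its polynomial variable replaced by \<open>S\<close>)
  to the coefficients of \<open>p\<close>, the variable of \<open>p\<close> being replaced by \<open>T\<close>. For instance
  \<open>psubst2 S (B u) T (B v w)\<close> is \<open>[u\<^sub>S [v\<^sub>T w]]\<close>, and
  \<open>psubst2 S (\<lambda>c. B c w) T (B u v)\<close> is \<open>[[u\<^sub>T v]\<^sub>S w]\<close>.
\<close>

definition psubst2 ::
  "('m poly poly \<Rightarrow> 'm poly poly) \<Rightarrow> ('e::zero \<Rightarrow> 'm::ab_group_add poly)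
    \<Rightarrow> ('m poly poly \<Rightarrow> 'm poly poly) \<Rightarrow> 'e poly \<Rightarrow> 'm poly poly" where
  "psubst2 S f T p = psubst T (\<lambda>c. psubst S const2 (f c)) p"

text \<open>
  \<open>flip D p\<close> is \<open>p(-\<lambda> - \<partial>)\<close> with \<open>\<partial>\<close> acting on the coefficients of \<open>p\<close>, i.e.
  \<open>\<Sum>\<^sub>i (-\<lambda> - \<partial>)\<^sup>i (p\<^sub>i)\<close>. It gives the adjoint symbol as well as the right-hand side (up to sign)
  of skewsymmetry.
\<close>

definition flip :: "('e \<Rightarrow> 'e) \<Rightarrow> 'e::ab_group_add poly \<Rightarrow> 'e poly" where
  "flip D p = psubst (neg_lam_plus D) const1 p"

text \<open>
  In the next three definitions \<open>sm :: 'a \<Rightarrow> 'e \<Rightarrow> 'e\<close> is the action of the algebra on the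
  coefficient module, \<open>D\<close> is \<open>\<partial>\<close> on the module and \<open>d\<close> is \<open>\<partial>\<close> on the algebra.

  \<open>subst_right sm D a p\<close> is \<open>a(\<lambda> + x) (|\<^sub>x\<^sub>=\<^sub>\<partial> p)\<close>, i.e. \<open>\<Sum>\<^sub>i a\<^sub>i (\<lambda> + \<partial>)\<^sup>i p\<close>.

  \<open>subst_arg sm D \<phi> a v\<close> is \<open>\<phi>\<^sub>\<lambda>(a(x)) (|\<^sub>x\<^sub>=\<^sub>\<partial> v)\<close>, i.e. \<open>\<Sum>\<^sub>i \<phi>\<^sub>\<lambda>(a\<^sub>i) \<partial>\<^sup>i v\<close>.

  \<open>subst_left sm d q p\<close> is \<open>(|\<^sub>x\<^sub>=\<^sub>\<partial> q(\<lambda>)) p(\<lambda> + x)\<close>, i.e. \<open>\<Sum>\<^sub>k ((\<lambda> + \<partial>)\<^sup>k q) p\<^sub>k\<close>.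
\<close>

definition subst_right ::
  "('a::zero \<Rightarrow> 'e \<Rightarrow> 'e) \<Rightarrow> ('e \<Rightarrow> 'e) \<Rightarrow> 'a poly \<Rightarrow> 'e::ab_group_add poly \<Rightarrow> 'e poly" where
  "subst_right sm D a p = (\<Sum>i\<le>degree a. map_poly (sm (coeff a i)) ((lam_plus D ^^ i) p))"

definition subst_arg ::
  "('a::zero \<Rightarrow> 'e \<Rightarrow> 'e) \<Rightarrow> ('e \<Rightarrow> 'e) \<Rightarrow> ('a \<Rightarrow> 'a poly) \<Rightarrow> 'a poly
    \<Rightarrow> 'e::ab_group_add \<Rightarrow> 'e poly" where
  "subst_arg sm D \<phi> a v =
    (\<Sum>i\<le>degree a. map_poly (\<lambda>c. sm c ((D ^^ i) v)) (\<phi> (coeff a i)))"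

definition subst_left ::
  "('a \<Rightarrow> 'e \<Rightarrow> 'e) \<Rightarrow> ('a \<Rightarrow> 'a) \<Rightarrow> 'a::ab_group_add poly
    \<Rightarrow> 'e::ab_group_add poly \<Rightarrow> 'e poly" where
  "subst_left sm d q p =
    (\<Sum>k\<le>degree p. map_poly (\<lambda>c. sm c (coeff p k)) ((lam_plus d ^^ k) q))"


section \<open>Differential algebras, differential operators and their modules\<close>

locale differential_algebra = vector_space scale
  for scale :: "'k::field_char_0 \<Rightarrow> 'a::comm_ring_1 \<Rightarrow> 'a" +
  fixes deriv :: "'a \<Rightarrow> 'a"
  assumes scale_mult: "scale c (a * b) = scale c a * b"
    and deriv_linear: "Vector_Spaces.linear scale scale deriv"
    and deriv_mult: "deriv (a * b) = deriv a * b + a * deriv b"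

text \<open>
  A differential operator is identified with its symbol in \<open>'a poly\<close>, so \<open>\<partial>\<close> is \<open>[:0, 1:]\<close> and
  \<open>f \<in> A\<close> is \<open>[:f:]\<close>. The symbol of the composition of \<open>a(\<partial>)\<close> and \<open>b(\<partial>)\<close> is
  \<open>\<Sum>\<^sub>i a\<^sub>i (x + \<partial>)\<^sup>i b(x)\<close>.
\<close>

definition dop_mult :: "('a \<Rightarrow> 'a) \<Rightarrow> 'a::comm_ring_1 poly \<Rightarrow> 'a poly \<Rightarrow> 'a poly" where
  "dop_mult d a b = subst_right (*) d a b"

locale dop_module = differential_algebra scale deriv
  for scale :: "'k::field_char_0 \<Rightarrow> 'a::comm_ring_1 \<Rightarrow> 'a" and deriv +
  fixes act :: "'a poly \<Rightarrow> 'm::ab_group_add \<Rightarrow> 'm"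
  assumes act_add_left: "act (a + b) m = act a m + act b m"
    and act_add_right: "act a (m + n) = act a m + act a n"
    and act_one: "act 1 m = m"
    and act_mult: "act (dop_mult deriv a b) m = act a (act b m)"

definition fun_act :: "('a::zero poly \<Rightarrow> 'm \<Rightarrow> 'm) \<Rightarrow> 'a \<Rightarrow> 'm \<Rightarrow> 'm" where
  "fun_act act f m = act [:f:] m"

definition del_act :: "('a::{zero,one} poly \<Rightarrow> 'm \<Rightarrow> 'm) \<Rightarrow> 'm \<Rightarrow> 'm" where
  "del_act act m = act [:0, 1:] m"

definition base_act ::
  "('k \<Rightarrow> 'a \<Rightarrow> 'a) \<Rightarrow> ('a::{zero,one} poly \<Rightarrow> 'm \<Rightarrow> 'm) \<Rightarrow> 'k \<Rightarrow> 'm \<Rightarrow> 'm" where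
  "base_act scale act c m = fun_act act (scale c 1) m"


section \<open>Lie conformal algebras\<close>

definition poly_linear ::
  "('k::field \<Rightarrow> 'e::ab_group_add \<Rightarrow> 'e) \<Rightarrow> ('k \<Rightarrow> 'm::ab_group_add \<Rightarrow> 'm)
    \<Rightarrow> ('e \<Rightarrow> 'm poly) \<Rightarrow> bool" where
  "poly_linear s t f \<longleftrightarrow> Vector_Spaces.linear s (\<lambda>c. map_poly (t c)) f"

definition poly_bilinear ::
  "('k::field \<Rightarrow> 'e::ab_group_add \<Rightarrow> 'e) \<Rightarrow> ('k \<Rightarrow> 'm::ab_group_add \<Rightarrow> 'm)
    \<Rightarrow> ('k \<Rightarrow> 'n::ab_group_add \<Rightarrow> 'n) \<Rightarrow> ('e \<Rightarrow> 'm \<Rightarrow> 'n poly) \<Rightarrow> bool" where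
  "poly_bilinear r s t f \<longleftrightarrow>
    (\<forall>u. poly_linear s t (\<lambda>m. f u m)) \<and> (\<forall>m. poly_linear r t (\<lambda>u. f u m))"

text \<open>An \<open>\<bbbF>[\<partial>]\<close>-module is a vector space with a linear endomorphism \<open>D\<close>.\<close>

locale lie_conformal_algebra = vector_space scale
  for scale :: "'k::field_char_0 \<Rightarrow> 'e::ab_group_add \<Rightarrow> 'e" +
  fixes D :: "'e \<Rightarrow> 'e"
    and bracket :: "'e \<Rightarrow> 'e \<Rightarrow> 'e poly"
  assumes D_linear: "Vector_Spaces.linear scale scale D"
    and bracket_bilinear: "poly_bilinear scale scale scale bracket"
    and sesqui_left: "bracket (D u) v = - pCons 0 (bracket u v)"
    and sesqui_right: "bracket u (D v) = lam_plus D (bracket u v)"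
    and skew: "bracket v u = - flip D (bracket u v)"
    and jacobi:
      "psubst2 lam (bracket u) mu (bracket v w) - psubst2 mu (bracket v) lam (bracket u w)
        = psubst2 lam_plus_mu (\<lambda>c. bracket c w) lam (bracket u v)"


section \<open>Lie conformal algebroids and their modules\<close>

context differential_algebra
begin

definition CDer :: "('a \<Rightarrow> 'a poly) set" where
  "CDer = {\<phi>. poly_linear scale scale \<phi> \<and>
    (\<forall>a. \<phi> (deriv a) = lam_plus deriv (\<phi> a)) \<and>
    (\<forall>a b. \<phi> (a * b) = smult b (\<phi> a) + smult a (\<phi> b))}"

definition CDer_act :: "'a poly \<Rightarrow> ('a \<Rightarrow> 'a poly) \<Rightarrow> 'a \<Rightarrow> 'a poly" where
  "CDer_act a \<phi> = (\<lambda>b. subst_left (*) deriv (flip deriv a) (\<phi> b))"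

end

locale lie_conformal_algebroid =
  dop_module scale deriv act +
  L: lie_conformal_algebra "base_act scale act" "del_act act" bracket
  for scale :: "'k::field_char_0 \<Rightarrow> 'a::comm_ring_1 \<Rightarrow> 'a" and deriv
    and act :: "'a poly \<Rightarrow> 'e::ab_group_add \<Rightarrow> 'e"
    and bracket :: "'e \<Rightarrow> 'e \<Rightarrow> 'e poly" +
  fixes anchor :: "'e \<Rightarrow> 'a \<Rightarrow> 'a poly"
  assumes anchor_CDer: "anchor u \<in> CDer"
    and anchor_add: "anchor (u + v) = (\<lambda>b. anchor u b + anchor v b)"
    and anchor_act: "anchor (act a u) = CDer_act a (anchor u)"
    and bracket_act:
      "bracket u (act a v) = subst_right (fun_act act) (del_act act) a (bracket u v)
        + subst_arg (fun_act act) (del_act act) (anchor u) a v"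
    and anchor_bracket:
      "psubst2 mu (\<lambda>w. anchor w b) lam (bracket u v)
        = psubst2 lam (anchor u) mu_minus_lam (anchor v b)
          - psubst2 mu_minus_lam (anchor v) lam (anchor u b)"

locale lcad_module =
  E: lie_conformal_algebroid scale deriv actE bracket anchor +
  M: dop_module scale deriv actM
  for scale :: "'k::field_char_0 \<Rightarrow> 'a::comm_ring_1 \<Rightarrow> 'a" and deriv
    and actE :: "'a poly \<Rightarrow> 'e::ab_group_add \<Rightarrow> 'e"
    and bracket :: "'e \<Rightarrow> 'e \<Rightarrow> 'e poly"
    and anchor :: "'e \<Rightarrow> 'a \<Rightarrow> 'a poly"
    and actM :: "'a poly \<Rightarrow> 'm::ab_group_add \<Rightarrow> 'm" +
  fixes lact :: "'e \<Rightarrow> 'm \<Rightarrow> 'm poly"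
  assumes lact_bilinear:
      "poly_bilinear (base_act scale actE) (base_act scale actM) (base_act scale actM) lact"
    and lact_act_right:
      "lact u (actM a m) = subst_right (fun_act actM) (del_act actM) a (lact u m)
        + subst_arg (fun_act actM) (del_act actM) (anchor u) a m"
    and lact_act_left:
      "lact (actE a u) m = subst_left (fun_act actM) deriv (flip deriv a) (lact u m)"
    and lact_bracket:
      "psubst2 mu (\<lambda>w. lact w m) lam (bracket u v)
        = psubst2 lam (lact u) mu_minus_lam (lact v m)
          - psubst2 mu_minus_lam (lact v) lam (lact u m)"


section \<open>Poisson vertex algebras and their modules\<close>

locale poisson_vertex_algebra =
  differential_algebra scale deriv +
  lie_conformal_algebra scale deriv bracket
  for scale :: "'k::field_char_0 \<Rightarrow> 'a::comm_ring_1 \<Rightarrow> 'a" and deriv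
    and bracket :: "'a \<Rightarrow> 'a \<Rightarrow> 'a poly" +
  assumes leibniz: "bracket f (g * h) = smult g (bracket f h) + smult h (bracket f g)"

locale pva_module =
  V: poisson_vertex_algebra scale deriv bracket +
  M: dop_module scale deriv actM
  for scale :: "'k::field_char_0 \<Rightarrow> 'a::comm_ring_1 \<Rightarrow> 'a" and deriv
    and bracket :: "'a \<Rightarrow> 'a \<Rightarrow> 'a poly"
    and actM :: "'a poly \<Rightarrow> 'm::ab_group_add \<Rightarrow> 'm" +
  fixes lact :: "'a \<Rightarrow> 'm \<Rightarrow> 'm poly"
  assumes lact_bilinear:
      "poly_bilinear scale (base_act scale actM) (base_act scale actM) lact"
    and lact_deriv_left: "lact (deriv f) m = - pCons 0 (lact f m)"
    and lact_del_right: "lact f (del_act actM m) = lam_plus (del_act actM) (lact f m)"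
    and lact_bracket:
      "psubst2 lam (lact f) mu (lact g m) - psubst2 mu (lact g) lam (lact f m)
        = psubst2 lam_plus_mu (\<lambda>h. lact h m) lam (bracket f g)"
    and lact_fun_right:
      "lact f (fun_act actM g m)
        = map_poly (\<lambda>h. fun_act actM h m) (bracket f g) + map_poly (fun_act actM g) (lact f m)"
    and lact_mult_left:
      "lact (f * g) m = subst_left (fun_act actM) deriv [:f:] (lact g m)
        + subst_left (fun_act actM) deriv [:g:] (lact f m)"


section \<open>Kaehler differentials\<close>

text \<open>
  The free \<open>A\<close>-module on the symbols \<open>dg\<close> (\<open>g \<in> A\<close>) is \<open>'a \<Rightarrow>\<^sub>0 'a\<close>, with \<open>f dg\<close> given by
  \<open>Poly_Mapping.single g f\<close>.
\<close>

definition free_scale :: "'a::comm_ring_1 \<Rightarrow> ('a \<Rightarrow>\<^sub>0 'a) \<Rightarrow> ('a \<Rightarrow>\<^sub>0 'a)" where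
  "free_scale f p = Poly_Mapping.map ((*) f) p"

definition kaehler_relations :: "('k \<Rightarrow> 'a \<Rightarrow> 'a) \<Rightarrow> ('a::comm_ring_1 \<Rightarrow>\<^sub>0 'a) set" where
  "kaehler_relations scale =
    {Poly_Mapping.single (g + h) 1 - Poly_Mapping.single g 1 - Poly_Mapping.single h 1 | g h. True}
    \<union> {Poly_Mapping.single (scale c g) 1 - Poly_Mapping.single g (scale c 1) | c g. True}
    \<union> {Poly_Mapping.single (f * g) 1 - Poly_Mapping.single g f - Poly_Mapping.single f g
        | f g. True}"

text \<open>
  The module \<open>\<Omega>(A)\<close> is determined up to isomorphism by its presentation, so it is given as a module
  on a type \<open>'e\<close> with a map \<open>diff :: 'a \<Rightarrow> 'e\<close> such that the \<open>A\<close>-linear map from the free module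
  to \<open>'e\<close> sending the symbol of \<open>g\<close> to \<open>diff g\<close> is onto, with kernel the submodule spanned by the
  relations.
\<close>

locale kaehler_differentials = dop_module scale deriv act
  for scale :: "'k::field_char_0 \<Rightarrow> 'a::comm_ring_1 \<Rightarrow> 'a" and deriv
    and act :: "'a poly \<Rightarrow> 'e::ab_group_add \<Rightarrow> 'e" +
  fixes diff :: "'a \<Rightarrow> 'e"
  assumes generated:
      "surj (\<lambda>p. \<Sum>g\<in>Poly_Mapping.keys p. fun_act act (Poly_Mapping.lookup p g) (diff g))"
    and presented:
      "(\<Sum>g\<in>Poly_Mapping.keys p. fun_act act (Poly_Mapping.lookup p g) (diff g)) = 0
        \<longleftrightarrow> p \<in> module.span free_scale (kaehler_relations scale)"
    and del_fun_diff:
      "del_act act (fun_act act f (diff g))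
        = fun_act act (deriv f) (diff g) + fun_act act f (diff (deriv g))"

text \<open>
  The Lie conformal algebroid \<open>\<Omega>(V)\<close> of a Poisson vertex algebra \<open>V\<close>. The last two conditions
  determine the anchor and the \<open>\<lambda>\<close>-bracket, because \<open>\<Omega>(V)\<close> is generated by the \<open>df\<close>.
\<close>

locale kaehler_algebroid =
  V: poisson_vertex_algebra scale deriv bracketV +
  kaehler_differentials scale deriv act diff +
  lie_conformal_algebroid scale deriv act bracket anchor
  for scale :: "'k::field_char_0 \<Rightarrow> 'a::comm_ring_1 \<Rightarrow> 'a" and deriv
    and bracketV :: "'a \<Rightarrow> 'a \<Rightarrow> 'a poly"
    and act :: "'a poly \<Rightarrow> 'e::ab_group_add \<Rightarrow> 'e" and diff
    and bracket :: "'e \<Rightarrow> 'e \<Rightarrow> 'e poly"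
    and anchor :: "'e \<Rightarrow> 'a \<Rightarrow> 'a poly" +
  assumes anchor_diff: "anchor (diff f) g = bracketV f g"
    and bracket_diff: "bracket (diff f) (diff g) = map_poly diff (bracketV f g)"

end

theory Submission
  imports Defs
begin

text \<open>
  A \<open>\<lambda>\<close>-action on \<open>M\<close> is restricted along \<open>d : \<V> \<rightarrow> \<Omega>(\<V>)\<close>, and conversely extended by
  \<open>\<beta>(\<Sum>\<^sub>i f\<^sub>i dg\<^sub>i) = \<Sum>\<^sub>i (|\<^sub>x\<^sub>=\<^sub>\<partial> f\<^sub>i) \<alpha>(g\<^sub>i)\<^sub>\<lambda>\<^sub>+\<^sub>x\<close>, which respects the relations of \<open>\<Omega>(\<V>)\<close> because of
  the left Leibniz rule for \<open>\<alpha>\<close>. Since the ground field is infinite, a polynomial with coefficients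
  in a vector space is determined by its values at scalars, so the Jacobi identity for \<open>(u, v)\<close>
  becomes \<open>u\<^sub>a(v\<^sub>b m) - v\<^sub>b(u\<^sub>a m) = [u\<^sub>a v]\<^sub>a\<^sub>+\<^sub>b m\<close> for all scalars \<open>a\<close> and \<open>b\<close>; in this form the
  substitution \<open>\<mu> = a + b\<close> relating the conventions for the two kinds of modules is trivial. If the
  identity holds for \<open>(u, v)\<close>, then it holds for \<open>(u, f v)\<close>, and by skewsymmetry for \<open>(v, u)\<close>.
  Hence it extends from pairs \<open>(df, dg)\<close> to all of \<open>\<Omega>(\<V>)\<close>.
\<close>

section \<open>Polynomials with coefficients in an additive group\<close>

lemma additive_funpow: "additive f \<Longrightarrow> additive (f ^^ n)" for f :: "'a::ab_group_add \<Rightarrow> 'a"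
  by (induction n) (simp_all add: additive_def)

lemma map_poly_add: "additive f \<Longrightarrow> map_poly f (p + q) = map_poly f p + map_poly f q"
  by (rule poly_eqI) (simp add: coeff_map_poly additive.zero additive.add)

lemma map_poly_pCons_additive:
  "additive f \<Longrightarrow> map_poly f (pCons r p) = pCons (f r) (map_poly f p)"
  by (simp add: map_poly_pCons additive.zero)

lemma additive_pCons_0: "additive (pCons 0 :: 'e::ab_group_add poly \<Rightarrow> 'e poly)"
  by (simp add: additive_def)

lemma additive_lam_plus: "additive D \<Longrightarrow> additive (lam_plus D)"
  by (simp add: additive_def lam_plus_def map_poly_add[unfolded additive_def])

text \<open>Every substitution is a sum of this shape, so splitting off the constant coefficient
  gives Horner recursions and reduces later proofs to induction along \<open>pCons\<close>. For
  \<open>p = 0\<close> the degree does not rise, and the surplus term \<open>h 1 0\<close>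
  vanishes.\<close>

lemma sum_coeff_pCons:
  assumes "\<And>i. h i 0 = (0::'b::comm_monoid_add)"
  shows "(\<Sum>i\<le>degree (pCons c p). h i (coeff (pCons c p) i))
    = h 0 c + (\<Sum>i\<le>degree p. h (Suc i) (coeff p i))"
proof (cases "p = 0")
  case True
  then show ?thesis using assms by simp
next
  case False
  then show ?thesis by (simp add: sum.atMost_Suc_shift del: sum.atMost_Suc)
qed

lemma psubst_pCons:
  assumes "additive T" "emb 0 = 0"
  shows "psubst T emb (pCons r p) = emb r + T (psubst T emb p)"
proof -
  have "psubst T emb (pCons r p) = emb r + (\<Sum>i\<le>degree p. (T ^^ Suc i) (emb (coeff p i)))"
    unfolding psubst_def
    by (subst sum_coeff_pCons) (simp_all add: assms(2) additive.zero additive_funpow[OF assms(1)])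
  then show ?thesis by (simp add: psubst_def additive.sum[OF assms(1)])
qed

lemma psubst_0: "additive T \<Longrightarrow> emb 0 = 0 \<Longrightarrow> psubst T emb 0 = 0"
  by (simp add: psubst_def)

lemma map_poly_zero_fun: "map_poly (\<lambda>_. 0) p = 0"
  by (rule poly_eqI) (simp add: coeff_map_poly)

section \<open>Substitutions for a biadditive action with compatible derivations\<close>

text \<open>Covers both multiplication of the differential algebra on itself and its action on an
  arbitrary \<open>A[\<partial>]\<close>-module.\<close>

locale module_action =
  fixes sm :: "'a::ab_group_add \<Rightarrow> 'e::ab_group_add \<Rightarrow> 'e"
    and d :: "'a \<Rightarrow> 'a" and D :: "'e \<Rightarrow> 'e"
  assumes sm_add_left: "sm (a + b) x = sm a x + sm b x"
    and sm_add_right: "sm a (x + y) = sm a x + sm a y"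
    and d_add: "additive d"
    and D_add: "additive D"
    and D_sm: "D (sm a x) = sm (d a) x + sm a (D x)"
begin

lemma additive_left: "additive (\<lambda>a. sm a x)"
  by (simp add: additive_def sm_add_left)

lemma additive_right: "additive (sm a)"
  by (simp add: additive_def sm_add_right)

lemma sm_0_left [simp]: "sm 0 x = 0"
  using additive.zero[OF additive_left] .

lemma sm_0_fun: "sm 0 = (\<lambda>_. 0)"
  by (rule ext) simp

lemma sm_0_right [simp]: "sm a 0 = 0"
  using additive.zero[OF additive_right] .

lemma subst_right_pCons:
  "subst_right sm D (pCons c a) p = map_poly (sm c) p + subst_right sm D a (lam_plus D p)"
  unfolding subst_right_def
  by (subst sum_coeff_pCons)
    (simp_all add: map_poly_zero_fun sm_0_fun funpow_Suc_right del: funpow.simps(2))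

lemma subst_right_0: "subst_right sm D 0 p = 0"
  by (simp add: subst_right_def sm_0_fun map_poly_zero_fun)

lemma subst_arg_pCons:
  assumes "\<phi> 0 = 0"
  shows "subst_arg sm D \<phi> (pCons c a) v
    = map_poly (\<lambda>h. sm h v) (\<phi> c) + subst_arg sm D \<phi> a (D v)"
  unfolding subst_arg_def
  by (subst sum_coeff_pCons) (simp_all add: assms sm_0_fun funpow_Suc_right del: funpow.simps(2))

lemma subst_arg_0: "\<phi> 0 = 0 \<Longrightarrow> subst_arg sm D \<phi> 0 v = 0"
  by (simp add: subst_arg_def)

lemma subst_left_0 [simp]: "subst_left sm d q 0 = 0"
  by (simp add: subst_left_def map_poly_zero_fun)

lemma subst_left_pCons:
  "subst_left sm d q (pCons r p) = map_poly (\<lambda>c. sm c r) q + subst_left sm d (lam_plus d q) p"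
  unfolding subst_left_def
  by (subst sum_coeff_pCons)
    (simp_all add: map_poly_zero_fun sm_0_fun funpow_Suc_right del: funpow.simps(2))

lemma subst_left_add_left:
  "subst_left sm d (q + q') p = subst_left sm d q p + subst_left sm d q' p"
  by (induction p arbitrary: q q')
    (simp_all add: subst_left_pCons map_poly_add[OF additive_left]
      additive.add[OF additive_lam_plus[OF d_add]])

lemma subst_left_add_right:
  "subst_left sm d q (p + p') = subst_left sm d q p + subst_left sm d q p'"
proof (induction p p' arbitrary: q rule: poly_induct2)
  case (pCons a p b p')
  have "map_poly (\<lambda>c. sm c (a + b)) q = map_poly (\<lambda>c. sm c a) q + map_poly (\<lambda>c. sm c b) q"
    by (rule poly_eqI) (simp add: coeff_map_poly sm_add_right)
  with pCons show ?case by (simp add: subst_left_pCons)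
qed simp

lemma subst_left_lam: "subst_left sm d (pCons 0 q) p = pCons 0 (subst_left sm d q p)"
proof (induction p arbitrary: q)
  case (pCons r p)
  have "lam_plus d (pCons 0 q) = pCons 0 (lam_plus d q)"
    by (simp add: lam_plus_def map_poly_pCons_additive[OF d_add] additive.zero[OF d_add])
  with pCons show ?case by (simp add: subst_left_pCons map_poly_pCons)
qed simp

text \<open>The k-th coefficient of \<open>p\<close> meets \<open>\<lambda> + \<partial>\<close>
  applied k times to \<open>q\<close>, so one more application amounts to raising all exponents of
  \<open>p\<close> by one.\<close>

lemma subst_left_shift: "subst_left sm d (lam_plus d q) p = subst_left sm d q (pCons 0 p)"
  by (simp add: subst_left_pCons map_poly_zero_fun)

text \<open>This is \<open>(|\<^sub>x\<^sub>=\<^sub>\<partial> f) p(\<lambda> + x)\<close>: what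
  happens to a \<lambda>-action when the acting element is multiplied by \<open>f\<close>.\<close>

abbreviation star :: "'a \<Rightarrow> 'e poly \<Rightarrow> 'e poly" where
  "star f \<equiv> subst_left sm d [:f:]"

text \<open>Splitting \<open>(\<lambda> + \<partial>) f\<close> into \<open>\<lambda> f\<close> and
  \<open>\<partial> f\<close> yields a recursion in which the first argument stays free of
  \<lambda>; the properties of \<open>star\<close> follow from it by induction.\<close>

lemma star_pCons: "star f (pCons r p) = [:sm f r:] + pCons 0 (star f p) + star (d f) p"
proof -
  have "lam_plus d [:f:] = pCons 0 [:f:] + [:d f:]"
    by (simp add: lam_plus_def map_poly_pCons_additive[OF d_add])
  then have "star f (pCons r p) = [:sm f r:] + (subst_left sm d (pCons 0 [:f:]) p + star (d f) p)"
    by (simp only: subst_left_pCons subst_left_add_left) (simp add: map_poly_pCons)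
  then show ?thesis
    by (simp only: subst_left_lam add.assoc)
qed

lemma star_add_left: "star (f + g) p = star f p + star g p"
  using subst_left_add_left[of "[:f:]" "[:g:]"] by simp

lemma additive_star: "additive (star f)"
  by (simp add: additive_def subst_left_add_right)

lemma star_0_left [simp]: "subst_left sm d 0 p = 0"
  using star_add_left[of 0 0 p] by simp

lemma star_commute:
  assumes "additive h" "\<And>f x. h (sm f x) = sm f (h x)"
  shows "star f (map_poly h p) = map_poly h (star f p)"
  by (induction p arbitrary: f)
    (simp_all add: star_pCons map_poly_pCons_additive[OF assms(1)] map_poly_add[OF assms(1)]
      assms additive.zero[OF assms(1)])

lemma star_del: "star f (map_poly D p) = map_poly D (star f p) - star (d f) p"
  by (induction p arbitrary: f)
    (simp_all add: star_pCons map_poly_pCons_additive[OF D_add] map_poly_add[OF D_add]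
      D_sm additive.zero[OF D_add] algebra_simps)

lemma star_lam: "star f (pCons 0 p) = pCons 0 (star f p) + star (d f) p"
  by (simp add: star_pCons)

text \<open>The corrections \<open>star (d f) p\<close> coming from \<lambda> and from
  \<open>D\<close> have opposite signs and cancel.\<close>

lemma star_lam_plus: "star f (lam_plus D p) = lam_plus D (star f p)"
  by (simp add: lam_plus_def additive.add[OF additive_star] star_lam star_del)

end

section \<open>Evaluation at scalars\<close>

definition peval :: "('k::field \<Rightarrow> 'e::ab_group_add \<Rightarrow> 'e) \<Rightarrow> 'e poly \<Rightarrow> 'k \<Rightarrow> 'e" where
  "peval s p c = psubst (s c) (\<lambda>x. x) p"

definition peval2 ::
  "('k::field \<Rightarrow> 'e::ab_group_add \<Rightarrow> 'e) \<Rightarrow> 'e poly poly \<Rightarrow> 'k \<Rightarrow> 'k \<Rightarrow> 'e" where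
  "peval2 s P a b = peval s (peval (\<lambda>c. map_poly (s c)) P a) b"

context vector_space
begin

lemma additive_scale: "additive (scale c)"
  by (simp add: additive_def scale_right_distrib)

lemma vector_space_map_poly: "vector_space (\<lambda>c. map_poly (scale c))"
  by unfold_locales
    (auto intro!: poly_eqI simp: coeff_map_poly scale_right_distrib scale_left_distrib)

lemma peval_0 [simp]: "peval scale 0 c = 0"
  by (simp add: peval_def psubst_def)

lemma peval_pCons: "peval scale (pCons r p) c = r + scale c (peval scale p c)"
  by (simp add: peval_def psubst_pCons additive_scale)

lemma peval_add: "peval scale (p + q) c = peval scale p c + peval scale q c"
  by (induction p q rule: poly_induct2) (simp_all add: peval_pCons scale_right_distrib)

lemma additive_peval: "additive (\<lambda>p. peval scale p c)"
  by (simp add: additive_def peval_add)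

lemmas peval_minus = additive.minus[OF additive_peval]
  and peval_diff = additive.diff[OF additive_peval]

lemma peval_const [simp]: "peval scale [:r:] c = r"
  by (simp add: peval_pCons)

lemma peval_map_poly:
  assumes "additive f" "\<And>c x. f (scale c x) = t c (f x)" "vector_space t"
  shows "peval t (map_poly f p) c = f (peval scale p c)"
proof -
  interpret t: vector_space t by fact
  show ?thesis
    by (induction p)
      (simp_all add: peval_pCons t.peval_pCons map_poly_pCons_additive assms additive.add
        additive.zero[OF assms(1)])
qed

lemma peval_scale: "peval scale (map_poly (scale a) p) c = scale a (peval scale p c)"
  by (rule peval_map_poly) (simp_all add: additive_scale scale_left_commute vector_space_axioms)

lemma peval_lam_plus:
  assumes "Vector_Spaces.linear scale scale D"
  shows "peval scale (lam_plus D p) c = scale c (peval scale p c) + D (peval scale p c)"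
proof -
  interpret D: Vector_Spaces.linear scale scale D by fact
  have "additive D" by (simp add: additive_def D.add)
  then show ?thesis
    by (simp add: lam_plus_def peval_add peval_pCons peval_map_poly
        D.scale vector_space_axioms)
qed

text \<open>If \<open>ev\<close> turns the operator \<open>T\<close> into the scalar
  \<open>t\<close>, it turns substitution of \<open>T\<close> into evaluation at
  \<open>t\<close>.\<close>

lemma psubst_eval:
  assumes "additive T" "emb 0 = 0" "additive ev" "\<And>x. ev (T x) = scale t (ev x)"
  shows "ev (psubst T emb p) = peval scale (map_poly (\<lambda>x. ev (emb x)) p) t"
  by (induction p)
    (simp_all add: psubst_0 psubst_pCons assms additive.zero[OF assms(3)] additive.add[OF assms(3)]
      map_poly_pCons peval_pCons)

end

section \<open>Polynomials are determined by their values at scalars\<close>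

text \<open>The functional is the coordinate along \<open>x\<close> in a basis extending
  \<open>{x}\<close>.\<close>

lemma (in vector_space) linear_separates:
  assumes "x \<noteq> 0"
  obtains f where "Vector_Spaces.linear scale (*) f" "f x \<noteq> 0"
proof
  let ?B = "extend_basis {x}"
  have ind: "independent {x}" using assms by simp
  have B: "independent ?B" "span ?B = UNIV" "x \<in> ?B"
    using ind independent_extend_basis[OF ind] span_extend_basis[OF ind] extend_basis_superset[OF ind]
    by auto
  interpret vector_space_pair scale "(*) :: 'a \<Rightarrow> 'a \<Rightarrow> 'a"
    by unfold_locales (simp_all add: algebra_simps)
  show "Vector_Spaces.linear scale (*) (\<lambda>v. representation ?B v x)"
    using B(1,2) by unfold_locales (simp_all add: representation_add representation_scale)
  show "representation ?B x x \<noteq> 0"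
    using B by (simp add: representation_basis)
qed

text \<open>A functional that detects a nonzero coefficient of \<open>p - q\<close> would turn
  \<open>p - q\<close> into a nonzero scalar polynomial vanishing everywhere, which is impossible
  over an infinite field.\<close>

lemma peval_eqI:
  fixes s :: "'k::field_char_0 \<Rightarrow> 'e::ab_group_add \<Rightarrow> 'e"
  assumes "vector_space s" "\<And>c. peval s p c = peval s q c"
  shows "p = q"
proof -
  interpret vector_space s by fact
  interpret k: vector_space "(*) :: 'k \<Rightarrow> 'k \<Rightarrow> 'k" by unfold_locales (simp_all add: algebra_simps)
  have "coeff (p - q) n = 0" for n
  proof (rule ccontr)
    assume "coeff (p - q) n \<noteq> 0"
    then obtain f where f: "Vector_Spaces.linear s (*) f" "f (coeff (p - q) n) \<noteq> 0"
      by (rule linear_separates)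
    interpret f: Vector_Spaces.linear s "(*)" f by fact
    have af: "additive f" by (simp add: additive_def f.add)
    have "peval (*) r c = poly r c" for r and c :: 'k
      by (induction r) (simp_all add: k.peval_pCons)
    then have "poly (map_poly f (p - q)) c = f (peval s (p - q) c)" for c
      using peval_map_poly[OF af f.scale k.vector_space_axioms] by metis
    then have "poly (map_poly f (p - q)) c = 0" for c
      by (simp add: peval_diff assms(2))
    then have "map_poly f (p - q) = 0"
      using poly_all_0_iff_0 by blast
    then show False
      using f(2) by (metis coeff_map_poly coeff_0 f.zero)
  qed
  then show ?thesis by (metis poly_eqI coeff_0 right_minus_eq)
qed

lemma peval2_eqI:
  fixes s :: "'k::field_char_0 \<Rightarrow> 'e::ab_group_add \<Rightarrow> 'e"
  assumes "vector_space s" "\<And>a b. peval2 s P a b = peval2 s Q a b"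
  shows "P = Q"
  by (rule peval_eqI[OF vector_space.vector_space_map_poly[OF assms(1)]])
    (rule peval_eqI[OF assms(1)], use assms(2) in \<open>simp add: peval2_def\<close>)

context vector_space
begin

interpretation poly: vector_space "\<lambda>c. map_poly (scale c)"
  by (rule vector_space_map_poly)

lemma additive_peval2: "additive (\<lambda>P. peval2 scale P a b)"
  by (simp add: additive_def peval2_def poly.peval_add peval_add)

lemmas peval2_add = additive.add[OF additive_peval2]
  and peval2_diff = additive.diff[OF additive_peval2]

lemma peval2_lam: "peval2 scale (lam P) a b = scale a (peval2 scale P a b)"
  by (simp add: peval2_def lam_def poly.peval_pCons peval_scale)

lemma peval2_mu: "peval2 scale (mu P) a b = scale b (peval2 scale P a b)"
proof -
  have "peval (\<lambda>c. map_poly (scale c)) (map_poly (pCons 0) P) a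
      = pCons 0 (peval (\<lambda>c. map_poly (scale c)) P a)"
    by (rule poly.peval_map_poly)
      (simp_all add: additive_pCons_0 map_poly_pCons vector_space_map_poly)
  then show ?thesis by (simp add: peval2_def mu_def peval_pCons)
qed

lemma peval2_lam_plus_mu: "peval2 scale (lam_plus_mu P) a b = scale (a + b) (peval2 scale P a b)"
  by (simp add: lam_plus_mu_def peval2_add peval2_lam peval2_mu scale_left_distrib)

lemma peval2_mu_minus_lam: "peval2 scale (mu_minus_lam P) a b = scale (b - a) (peval2 scale P a b)"
  by (simp add: mu_minus_lam_def peval2_diff peval2_lam peval2_mu scale_left_diff_distrib)

end

lemma additive_variables:
  "additive (lam :: 'e::ab_group_add poly poly \<Rightarrow> _)"
  "additive (mu :: 'e::ab_group_add poly poly \<Rightarrow> _)"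
  "additive (lam_plus_mu :: 'e::ab_group_add poly poly \<Rightarrow> _)"
  "additive (mu_minus_lam :: 'e::ab_group_add poly poly \<Rightarrow> _)"
  by (simp_all add: additive_def lam_def mu_def lam_plus_mu_def mu_minus_lam_def
      map_poly_add[OF additive_pCons_0])

lemma poly_linearD:
  assumes "poly_linear s t f"
  shows "vector_space s" "f (x + y) = f x + f y" "f (s c x) = map_poly (t c) (f x)"
    "additive f"
proof -
  interpret Vector_Spaces.linear s "\<lambda>c. map_poly (t c)" f
    using assms by (simp add: poly_linear_def)
  show "vector_space s" by unfold_locales
  show "f (x + y) = f x + f y" "f (s c x) = map_poly (t c) (f x)" by (simp_all add: add scale)
  show "additive f" by (simp add: additive_def add)
qed

lemma poly_linearI:
  assumes "vector_space s" "vector_space t"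
    and "\<And>x y. f (x + y) = f x + f y" "\<And>c x. f (s c x) = map_poly (t c) (f x)"
  shows "poly_linear s t f"
  unfolding poly_linear_def Vector_Spaces.linear_def module_hom_def module_hom_axioms_def
  using assms vector_space.vector_space_map_poly[OF assms(2)]
  by (simp add: module_iff_vector_space)

lemma peval_linear:
  assumes "poly_linear s t f" "vector_space t"
  shows "peval t (f (x + y)) c = peval t (f x) c + peval t (f y) c"
    and "peval t (f (s a x)) c = t a (peval t (f x) c)"
    and "additive (\<lambda>x. peval t (f x) c)"
proof -
  interpret t: vector_space t by fact
  show "peval t (f (x + y)) c = peval t (f x) c + peval t (f y) c" for x y
    by (simp add: poly_linearD(2)[OF assms(1)] t.peval_add)
  then show "additive (\<lambda>x. peval t (f x) c)" by (simp add: additive_def)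
  show "peval t (f (s a x)) c = t a (peval t (f x) c)"
    by (simp add: poly_linearD(3)[OF assms(1)] t.peval_scale)
qed

section \<open>Identities in two variables at scalars\<close>

text \<open>Evaluation turns \<open>S\<close> and \<open>T\<close> into \<sigma> and \<tau>, in the
  inner and then the outer substitution. What remains is linear in the coefficients of
  \<open>p\<close>, so it commutes with evaluating \<open>p\<close> at \<tau>.\<close>

lemma peval2_psubst2:
  fixes t :: "'k::field \<Rightarrow> 'm::ab_group_add \<Rightarrow> 'm"
  assumes "poly_linear s t f" "vector_space t" "additive S" "additive T"
    and S: "\<And>P. peval2 t (S P) a b = t \<sigma> (peval2 t P a b)"
    and T: "\<And>P. peval2 t (T P) a b = t \<tau> (peval2 t P a b)"
  shows "peval2 t (psubst2 S f T p) a b = peval t (f (peval s p \<tau>)) \<sigma>"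
proof -
  interpret t: vector_space t by fact
  interpret s: vector_space s by (rule poly_linearD(1)[OF assms(1)])
  interpret tp: vector_space "\<lambda>c. map_poly (t c)" by (rule t.vector_space_map_poly)
  have c0: "const2 0 = (0 :: 'm poly poly)" by (simp add: const2_def)
  have c: "peval2 t (const2 x) a b = x" for x
    by (simp add: const2_def peval2_def tp.peval_pCons t.peval_pCons)
  have inner: "peval2 t (psubst S const2 q) a b = peval t q \<sigma>" for q
    by (subst t.psubst_eval[where ev = "\<lambda>P. peval2 t P a b" and t = \<sigma>])
      (simp_all add: assms(3) c0 t.additive_peval2 S c)
  have f0: "f 0 = 0" using additive.zero[OF poly_linearD(4)[OF assms(1)]] .
  have "peval2 t (psubst2 S f T p) a b = peval t (map_poly (\<lambda>x. peval t (f x) \<sigma>) p) \<tau>"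
    unfolding psubst2_def
    by (subst t.psubst_eval[where ev = "\<lambda>P. peval2 t P a b" and t = \<tau>])
      (simp_all add: assms(3,4) c0 t.additive_peval2 T inner f0 psubst_0)
  also have "\<dots> = peval t (f (peval s p \<tau>)) \<sigma>"
    by (rule s.peval_map_poly) (simp_all add: peval_linear[OF assms(1,2)] assms(2))
  finally show ?thesis .
qed

text \<open>The first identity has the form used for PVA modules, the second the form used for LCAd
  modules; both amount to the same family of scalar identities.\<close>

lemma psubst2_eq_iff:
  fixes t :: "'k::field_char_0 \<Rightarrow> 'm::ab_group_add \<Rightarrow> 'm"
  assumes t: "vector_space t" and "vector_space r"
    and F: "poly_linear t t f" and G: "poly_linear t t g" and H: "poly_linear r t h"
  shows "psubst2 lam f mu q - psubst2 mu g lam p = psubst2 lam_plus_mu h lam w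
      \<longleftrightarrow> (\<forall>a b. peval t (f (peval t q b)) a - peval t (g (peval t p a)) b
          = peval t (h (peval r w a)) (a + b))" (is "?A \<longleftrightarrow> ?A'")
    and "psubst2 mu h lam w = psubst2 lam f mu_minus_lam q - psubst2 mu_minus_lam g lam p
      \<longleftrightarrow> (\<forall>a b. peval t (f (peval t q b)) a - peval t (g (peval t p a)) b
          = peval t (h (peval r w a)) (a + b))" (is "?B \<longleftrightarrow> ?A'")
proof -
  interpret t: vector_space t by fact
  note ev = peval2_psubst2[OF F t] peval2_psubst2[OF G t] peval2_psubst2[OF H t]
  note ops = additive_variables t.peval2_lam t.peval2_mu t.peval2_lam_plus_mu t.peval2_mu_minus_lam
  have "?A \<longleftrightarrow> (\<forall>a b. peval2 t (psubst2 lam f mu q - psubst2 mu g lam p) a b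
      = peval2 t (psubst2 lam_plus_mu h lam w) a b)"
    using peval2_eqI[OF t] by metis
  also have "\<dots> \<longleftrightarrow> ?A'"
    by (simp add: t.peval2_diff ev[OF ops(1,2,5,6)] ev[OF ops(2,1,6,5)] ev[OF ops(3,1,7,5)])
  finally show "?A \<longleftrightarrow> ?A'" .
  have "?B \<longleftrightarrow> (\<forall>a b. peval2 t (psubst2 mu h lam w) a b
      = peval2 t (psubst2 lam f mu_minus_lam q - psubst2 mu_minus_lam g lam p) a b)"
    using peval2_eqI[OF t] by metis
  also have "\<dots> \<longleftrightarrow> (\<forall>a b. peval t (f (peval t q (b - a))) a - peval t (g (peval t p a)) (b - a)
          = peval t (h (peval r w a)) b)"
    by (auto simp: t.peval2_diff ev[OF ops(2,1,6,5)] ev[OF ops(1,4,5,8)] ev[OF ops(4,1,8,5)])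
  \<comment> \<open>For fixed \<open>a\<close>, the scalar \<open>b - a\<close> takes every value as
    \<open>b\<close> varies, so \<open>b\<close> may be replaced by \<open>a + b\<close>.\<close>
  also have "\<dots> \<longleftrightarrow> ?A'"
    by (metis add_diff_cancel_left' add.commute diff_add_cancel)
  finally show "?B \<longleftrightarrow> ?A'" .
qed

section \<open>Modules over differential operators\<close>

context differential_algebra
begin

interpretation deriv: Vector_Spaces.linear scale scale deriv
  by (rule deriv_linear)

lemma additive_deriv: "additive deriv"
  by (simp add: additive_def deriv.add)

lemma deriv_scale: "deriv (scale c a) = scale c (deriv a)"
  by (rule deriv.scale)

lemma deriv_1 [simp]: "deriv 1 = 0"
  using deriv_mult[of 1 1] by simp

lemma deriv_0 [simp]: "deriv 0 = 0"
  by (rule deriv.zero)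

lemma scale_one_mult: "scale c 1 * a = scale c a"
  by (simp flip: scale_mult)

sublocale regular: module_action "(*)" deriv deriv
  by unfold_locales
    (simp_all add: algebra_simps additive_deriv additive.add[OF additive_deriv] deriv_mult)

text \<open>Since \<partial> kills the coefficient 1, \<open>\<lambda> + \<partial>\<close> merely
  raises the exponent of \<open>monom 1 n\<close>. The induction needs all \<open>n\<close> because
  each step raises it.\<close>

lemma dop_mult_del: "dop_mult deriv a [:0, 1:] = pCons 0 a"
proof -
  have lp: "lam_plus deriv (monom 1 n) = monom 1 (Suc n)" for n
    by (rule poly_eqI) (auto simp: lam_plus_def coeff_map_poly coeff_pCons split: nat.split)
  have "subst_right (*) deriv a (monom 1 n) = a * monom 1 n" for n
  proof (induction a arbitrary: n)
    case (pCons c a)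
    have "map_poly ((*) c) (monom 1 n) = smult c (monom 1 n)"
      by (rule poly_eqI) (simp add: coeff_map_poly)
    with pCons show ?case
      by (simp add: regular.subst_right_pCons lp) (simp add: monom_Suc)
  qed (simp add: regular.subst_right_0)
  from this[of 1] show ?thesis
    by (simp add: dop_mult_def monom_Suc monom_0)
qed

lemma flip_const: "flip deriv [:f:] = [:f:]"
  by (simp add: flip_def psubst_def const1_def)

lemma flip_pCons:
  "flip deriv (pCons c a) = [:c:] - lam_plus deriv (flip deriv a)"
proof -
  have "additive (neg_lam_plus deriv)"
    using additive_lam_plus[OF additive_deriv] by (simp add: additive_def neg_lam_plus_def)
  then show ?thesis
    by (simp add: flip_def psubst_pCons const1_def neg_lam_plus_def)
qed

lemma flip_0: "flip deriv 0 = 0"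
  by (simp add: flip_def psubst_def const1_def)

end

section \<open>Functions, the derivation and scalars acting on a module\<close>

context dop_module
begin

lemma act_0_left [simp]: "act 0 m = 0"
  using act_add_left[of 0 0 m] by simp

lemma fun_act_mult: "fun_act act f (fun_act act g m) = fun_act act (f * g) m"
proof -
  have "dop_mult deriv [:f:] [:g:] = [:f * g:]"
    by (simp add: dop_mult_def subst_right_def map_poly_pCons)
  then show ?thesis using act_mult by (metis fun_act_def)
qed

lemma fun_act_add_left: "fun_act act (f + g) m = fun_act act f m + fun_act act g m"
  using act_add_left[of "[:f:]" "[:g:]"] by (simp add: fun_act_def)

lemma fun_act_1 [simp]: "fun_act act 1 m = m"
  using act_one by (simp add: fun_act_def one_pCons)

text \<open>The symbol \<open>pCons 0 a\<close> is the composition of \<open>a(\<partial>)\<close>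
  with \<partial> on the right. This allows induction on operators from the actions of functions and
  \<partial> alone.\<close>

lemma act_pCons: "act (pCons c a) m = fun_act act c m + act a (del_act act m)"
proof -
  have "act (pCons c a) m = act [:c:] m + act (pCons 0 a) m"
    by (simp flip: act_add_left)
  also have "act (pCons 0 a) m = act a (del_act act m)"
    using act_mult[of a "[:0, 1:]" m] by (simp add: dop_mult_del del_act_def)
  finally show ?thesis by (simp add: fun_act_def)
qed

lemma del_fun_act:
  "del_act act (fun_act act f m) = fun_act act (deriv f) m + fun_act act f (del_act act m)"
proof -
  have "dop_mult deriv [:0, 1:] [:f:] = [:deriv f, f:]"
    by (simp add: dop_mult_def subst_right_def lam_plus_def map_poly_pCons
        regular.sm_0_fun map_poly_zero_fun)
  then have "del_act act (fun_act act f m) = act [:deriv f, f:] m"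
    by (metis act_mult del_act_def fun_act_def)
  then show ?thesis by (simp add: act_pCons)
qed

sublocale fin: module_action "fun_act act" deriv "del_act act"
  by unfold_locales
    (simp_all add: fun_act_add_left additive.add[OF additive_deriv] del_fun_act,
     simp_all add: fun_act_def del_act_def act_add_right)

sublocale base: vector_space "base_act scale act"
  by unfold_locales
    (simp_all add: base_act_def fin.sm_add_right scale_left_distrib fun_act_add_left fun_act_mult
      scale_one_mult)

lemma fun_act_scale: "fun_act act (scale c f) m = base_act scale act c (fun_act act f m)"
  by (simp add: base_act_def fun_act_mult scale_one_mult)

lemma fun_act_base: "fun_act act f (base_act scale act c m) = base_act scale act c (fun_act act f m)"
  by (simp add: base_act_def fun_act_mult mult.commute)

lemma del_linear:
  "Vector_Spaces.linear (base_act scale act) (base_act scale act) (del_act act)"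
  unfolding Vector_Spaces.linear_def module_hom_def module_hom_axioms_def
  using base.vector_space_axioms
  by (simp add: module_iff_vector_space additive.add[OF fin.D_add] base_act_def del_fun_act
      deriv_scale)

abbreviation eval :: "'m poly \<Rightarrow> 'k \<Rightarrow> 'm" where
  "eval \<equiv> peval (base_act scale act)"

lemma eval_fun_act: "eval (map_poly (fun_act act f) p) c = fun_act act f (eval p c)"
  by (rule base.peval_map_poly)
    (simp_all add: fin.additive_right fun_act_base base.vector_space_axioms)

lemma eval_fun_act_left: "eval (map_poly (\<lambda>h. fun_act act h m) q) c = fun_act act (peval scale q c) m"
  by (rule peval_map_poly)
    (simp_all add: fin.additive_left fun_act_scale base.vector_space_axioms)

lemma star_1 [simp]: "fin.star 1 p = p"
  by (induction p) (simp_all add: fin.star_pCons)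

lemma star_mult: "fin.star f (fin.star g p) = fin.star (f * g) p"
  by (induction p arbitrary: f g)
    (simp_all add: fin.star_pCons fin.subst_left_add_right deriv_mult fin.star_add_left fun_act_mult
      algebra_simps)

lemma star_scale: "fin.star (scale c f) p = map_poly (base_act scale act c) (fin.star f p)"
  by (induction p arbitrary: f)
    (simp_all add: fin.star_pCons deriv_scale fun_act_scale map_poly_add base.additive_scale
      map_poly_pCons)

lemma star_map_act:
  "fin.star f (map_poly (\<lambda>h. fun_act act h m) q) = map_poly (\<lambda>h. fun_act act h m) (regular.star f q)"
  by (induction q arbitrary: f)
    (simp_all add: fin.star_pCons regular.star_pCons fun_act_mult
      map_poly_add[OF fin.additive_left] map_poly_pCons)

text \<open>\<open>(|\<^sub>x\<^sub>=\<^sub>\<partial> f) Q(b + x)\<close> depends on \<open>Q\<close> and \<open>b\<close> only through the polynomial \<open>Q(b + x)\<close>.\<close>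

lemma star_shift:
  "\<exists>Q. (\<forall>b. eval Q b = eval R (a + b))
    \<and> (\<forall>f b. eval (fin.star f Q) b = eval (fin.star f R) (a + b))"
proof (induction R)
  case 0
  show ?case by (rule exI[of _ 0]) simp
next
  case (pCons r R)
  then obtain Q where Q: "\<And>b. eval Q b = eval R (a + b)"
    "\<And>f b. eval (fin.star f Q) b = eval (fin.star f R) (a + b)"
    by blast
  \<comment> \<open>If \<open>Q(x) = R(a + x)\<close>, then \<open>r + y R(y)\<close> at
    \<open>y = a + x\<close> is \<open>r + (x + a) Q(x)\<close>.\<close>
  let ?Q = "pCons r Q + map_poly (base_act scale act a) Q"
  have "eval ?Q b = eval (pCons r R) (a + b)" for b
    by (simp add: base.peval_add base.peval_pCons base.peval_scale Q base.scale_left_distrib)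
  moreover have "eval (fin.star f ?Q) b = eval (fin.star f (pCons r R)) (a + b)" for f b
    by (simp add: fin.star_pCons fin.subst_left_add_right fin.star_commute base.additive_scale
        fun_act_base base.peval_add base.peval_pCons base.peval_scale Q base.scale_left_distrib)
  ultimately show ?case by blast
qed

text \<open>Here \<open>U\<close> stands for \<open>u\<^sub>a\<close> and \<open>\<theta>\<close> for \<open>\<theta>(u)\<^sub>a\<close>, so that \<open>\<theta> \<circ> \<partial> = (a + \<partial>) \<circ> \<theta>\<close>: this moves
  the evaluation point in the last term from \<open>b\<close> to \<open>a + b\<close>.\<close>

lemma eval_star_derivation:
  assumes "additive U" "\<And>c x. U (base_act scale act c x) = base_act scale act c (U x)"
    and "\<And>g x. U (fun_act act g x) = fun_act act g (U x) + fun_act act (\<theta> g) x"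
    and "\<And>g. \<theta> (deriv g) = scale a (\<theta> g) + deriv (\<theta> g)"
  shows "U (eval (fin.star f p) b)
    = eval (fin.star f (map_poly U p)) b + eval (fin.star (\<theta> f) p) (a + b)"
  by (induction p arbitrary: f)
    (simp_all add: fin.star_pCons base.peval_add base.peval_pCons additive.add[OF assms(1)]
      additive.zero[OF assms(1)] assms(2-4) map_poly_pCons fin.star_add_left star_scale
      base.peval_scale base.scale_left_distrib base.scale_right_distrib)

end

section \<open>Actions of a Lie conformal algebroid\<close>

locale algebroid_pair =
  lie_conformal_algebroid scale deriv act bracket anchor +
  M: dop_module scale deriv actM
  for scale :: "'k::field_char_0 \<Rightarrow> 'a::comm_ring_1 \<Rightarrow> 'a" and deriv
    and act :: "'a poly \<Rightarrow> 'e::ab_group_add \<Rightarrow> 'e"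
    and bracket :: "'e \<Rightarrow> 'e \<Rightarrow> 'e poly"
    and anchor :: "'e \<Rightarrow> 'a \<Rightarrow> 'a poly"
    and actM :: "'a poly \<Rightarrow> 'm::ab_group_add \<Rightarrow> 'm"
begin

lemma anchor_linear: "poly_linear scale scale (anchor u)"
  and anchor_deriv: "anchor u (deriv f) = lam_plus deriv (anchor u f)"
  and anchor_mult: "anchor u (f * g) = smult g (anchor u f) + smult f (anchor u g)"
  using anchor_CDer[of u] by (auto simp: CDer_def)

lemma anchor_0 [simp]: "anchor u 0 = 0"
  using additive.zero[OF poly_linearD(4)[OF anchor_linear]] .

lemma anchor_1 [simp]: "anchor u 1 = 0"
  using anchor_mult[of u 1 1] by simp

lemma anchor_fun_act: "anchor (fun_act act f u) g = regular.star f (anchor u g)"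
  by (simp add: fun_act_def anchor_act CDer_act_def flip_const)

lemma bracket_fun_act:
  "bracket u (fun_act act f v)
    = map_poly (fun_act act f) (bracket u v) + map_poly (\<lambda>h. fun_act act h v) (anchor u f)"
  using bracket_act[of u "[:f:]" v]
  by (simp add: fun_act_def[of act f v] fin.subst_right_pCons fin.subst_right_0 fin.subst_arg_pCons fin.subst_arg_0)

text \<open>Stated for a single pair, so that the identity can be spread from generators one
  argument at a time.\<close>

definition jacobi_on :: "('e \<Rightarrow> 'm \<Rightarrow> 'm poly) \<Rightarrow> 'e \<Rightarrow> 'e \<Rightarrow> bool" where
  "jacobi_on \<beta> u v \<longleftrightarrow> (\<forall>a b m. M.eval (\<beta> u (M.eval (\<beta> v m) b)) a - M.eval (\<beta> v (M.eval (\<beta> u m) a)) b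
    = M.eval (\<beta> (eval (bracket u v) a) m) (a + b))"

end

text \<open>The LCAd module axioms apart from the Jacobi identity, with the rules for
  \<open>a(\<partial>)\<close> required only for functions and for \<partial>, which generate all
  operators.\<close>

locale algebroid_action = algebroid_pair scale deriv act bracket anchor actM
  for scale :: "'k::field_char_0 \<Rightarrow> 'a::comm_ring_1 \<Rightarrow> 'a" and deriv
    and act :: "'a poly \<Rightarrow> 'e::ab_group_add \<Rightarrow> 'e"
    and bracket :: "'e \<Rightarrow> 'e \<Rightarrow> 'e poly"
    and anchor :: "'e \<Rightarrow> 'a \<Rightarrow> 'a poly"
    and actM :: "'a poly \<Rightarrow> 'm::ab_group_add \<Rightarrow> 'm" +
  fixes \<beta> :: "'e \<Rightarrow> 'm \<Rightarrow> 'm poly"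
  assumes bilinear:
      "poly_bilinear (base_act scale act) (base_act scale actM) (base_act scale actM) \<beta>"
    and fun_left: "\<beta> (fun_act act f u) m = M.fin.star f (\<beta> u m)"
    and del_left: "\<beta> (del_act act u) m = - pCons 0 (\<beta> u m)"
    and fun_right: "\<beta> u (fun_act actM f m)
      = map_poly (fun_act actM f) (\<beta> u m) + map_poly (\<lambda>h. fun_act actM h m) (anchor u f)"
    and del_right: "\<beta> u (del_act actM m) = lam_plus (del_act actM) (\<beta> u m)"
begin

lemma linear_right: "poly_linear (base_act scale actM) (base_act scale actM) (\<beta> u)"
  and linear_left: "poly_linear (base_act scale act) (base_act scale actM) (\<lambda>u. \<beta> u m)"
  using bilinear by (auto simp: poly_bilinear_def)

lemmas add_right = poly_linearD(2)[OF linear_right]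
  and add_left = poly_linearD(2)[OF linear_left]
  and eval_right = peval_linear[OF linear_right M.base.vector_space_axioms]
  and eval_left = peval_linear[OF linear_left M.base.vector_space_axioms]

lemma zero_left [simp]: "\<beta> 0 m = 0" and zero_right [simp]: "\<beta> u 0 = 0"
  using additive.zero[OF poly_linearD(4)[OF linear_left]]
    additive.zero[OF poly_linearD(4)[OF linear_right]] by auto

text \<open>After splitting off the constant term of the operator, the factor
  \<open>-\<lambda>\<close> produced by \<open>\<partial> u\<close> moves to the adjoint symbol as
  \<open>-(\<lambda> + \<partial>)\<close>, which is the recursion for \<open>flip\<close>.\<close>

lemma dop_left:
  "\<beta> (act a u) m = subst_left (fun_act actM) deriv (flip deriv a) (\<beta> u m)"
proof (induction a arbitrary: u)
  case 0
  show ?case by (simp add: flip_0)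
next
  case (pCons c a)
  let ?s = "subst_left (fun_act actM) deriv"
  have "additive (\<lambda>q. ?s q p)" "additive (?s q)" for p q
    by (simp_all add: additive_def M.fin.subst_left_add_left M.fin.subst_left_add_right)
  note diff = additive.diff[OF this(1)] additive.minus[OF this(2)]
  show ?case
    by (simp add: act_pCons add_left fun_left pCons.IH del_left flip_pCons diff
        M.fin.subst_left_shift del: minus_pCons)
qed

lemma dop_right:
  "\<beta> u (actM a m) = subst_right (fun_act actM) (del_act actM) a (\<beta> u m)
    + subst_arg (fun_act actM) (del_act actM) (anchor u) a m"
  by (induction a arbitrary: m)
    (simp_all add: M.fin.subst_right_0 M.fin.subst_arg_0 M.fin.subst_right_pCons
      M.fin.subst_arg_pCons M.act_pCons add_right fun_right del_right)

section \<open>Spreading the Jacobi identity to further pairs\<close>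

lemma jacobi_on_add:
  assumes "jacobi_on \<beta> u v" "jacobi_on \<beta> u w"
  shows "jacobi_on \<beta> u (v + w)"
proof -
  have "bracket u (v + w) = bracket u v + bracket u w"
    using L.bracket_bilinear by (auto simp: poly_bilinear_def dest: poly_linearD(2))
  with assms show ?thesis
    by (simp add: jacobi_on_def eval_right eval_left add_left M.base.peval_add base.peval_add algebra_simps)
qed

text \<open>Apply \<open>star f\<close> to the identity for \<open>(u, v)\<close>, read as an
  equality of polynomials in the parameter of \<open>v\<close>. Moving \<open>u\<close> past
  \<open>f\<close> then costs a term with \<open>\<theta>(u)(f)\<close>, and the bracket of
  \<open>u\<close> with \<open>f v\<close> contributes the same term.\<close>

lemma jacobi_on_fun_act:
  assumes "jacobi_on \<beta> u v"
  shows "jacobi_on \<beta> u (fun_act act f v)"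
  unfolding jacobi_on_def
proof (intro allI)
  fix a b m
  define U where "U m = M.eval (\<beta> u m) a" for m
  define \<theta> where "\<theta> g = peval scale (anchor u g) a" for g
  let ?w = "eval (bracket u v) a"
  have U: "additive U"
    unfolding U_def by (rule eval_right(3))
  have U': "U (base_act scale actM c x) = base_act scale actM c (U x)"
    "U (fun_act actM g x) = fun_act actM g (U x) + fun_act actM (\<theta> g) x" for c x g
    by (simp_all add: U_def \<theta>_def eval_right fun_right M.base.peval_add M.eval_fun_act
        M.eval_fun_act_left)
  have \<theta>: "\<theta> (deriv g) = scale a (\<theta> g) + deriv (\<theta> g)" for g
    by (simp add: \<theta>_def anchor_deriv peval_lam_plus deriv_linear)
  \<comment> \<open>\<open>Q\<close> is the polynomial
    \<open>[u\<^sub>a v]\<^sub>a\<^sub>+\<^sub>x m\<close> in \<open>x\<close>.\<close>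
  obtain Q where Q: "\<And>b. M.eval Q b = M.eval (\<beta> ?w m) (a + b)"
    "\<And>b. M.eval (M.fin.star f Q) b = M.eval (M.fin.star f (\<beta> ?w m)) (a + b)"
    using M.star_shift by blast
  \<comment> \<open>\<open>star f\<close> involves the whole polynomial and not one value, so
    agreement at all scalars \<open>b\<close> has to be upgraded to equality.\<close>
  have "Q = map_poly U (\<beta> v m) - \<beta> v (U m)"
  proof (rule peval_eqI[OF M.base.vector_space_axioms])
    fix b
    have "M.eval (map_poly U (\<beta> v m)) b = U (M.eval (\<beta> v m) b)"
      by (rule M.base.peval_map_poly) (simp_all add: U U' M.base.vector_space_axioms)
    then show "M.eval Q b = M.eval (map_poly U (\<beta> v m) - \<beta> v (U m)) b"
      using assms by (simp add: M.base.peval_diff Q(1) jacobi_on_def U_def)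
  qed
  then have "M.eval (M.fin.star f (map_poly U (\<beta> v m))) b - M.eval (M.fin.star f (\<beta> v (U m))) b
      = M.eval (M.fin.star f (\<beta> ?w m)) (a + b)"
    using Q(2)[of b] by (simp add: additive.diff[OF M.fin.additive_star] M.base.peval_diff)
  moreover have "U (M.eval (M.fin.star f (\<beta> v m)) b)
      = M.eval (M.fin.star f (map_poly U (\<beta> v m))) b + M.eval (M.fin.star (\<theta> f) (\<beta> v m)) (a + b)"
    using M.eval_star_derivation[of U \<theta> a] U U' \<theta> by blast
  \<comment> \<open>The summand with \<open>\<theta> f\<close> accounts for the
    \<open>star (\<theta> f)\<close> term at \<open>a + b\<close> above.\<close>
  moreover have "eval (bracket u (fun_act act f v)) a = fun_act act f ?w + fun_act act (\<theta> f) v"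
    by (simp add: bracket_fun_act base.peval_add eval_fun_act eval_fun_act_left \<theta>_def)
  ultimately show "M.eval (\<beta> u (M.eval (\<beta> (fun_act act f v) m) b)) a
      - M.eval (\<beta> (fun_act act f v) (M.eval (\<beta> u m) a)) b
      = M.eval (\<beta> (eval (bracket u (fun_act act f v)) a) m) (a + b)"
    by (simp add: fun_left add_left M.base.peval_add flip: U_def)
qed

text \<open>At the parameter \<open>c\<close>, applying \<partial> to the acting element is
  multiplication by \<open>-c\<close>, so \<open>-a - \<partial>\<close> becomes the scalar
  \<open>c - a\<close>.\<close>

lemma eval_flip: "M.eval (\<beta> (eval (flip (del_act act) p) a) m) c = M.eval (\<beta> (eval p (c - a)) m) c"
proof -
  let ?ev = "\<lambda>q. M.eval (\<beta> (eval q a) m) c"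
  have T: "additive (neg_lam_plus (del_act act))"
    using additive_lam_plus[OF fin.D_add] by (simp add: additive_def neg_lam_plus_def)
  have ev: "additive ?ev"
    by (simp add: additive_def base.peval_add eval_left)
  have "?ev (lam_plus (del_act act) q) = base_act scale actM (a - c) (?ev q)" for q
    by (simp add: base.peval_lam_plus del_linear eval_left del_left M.base.peval_minus
        M.base.peval_pCons M.base.scale_left_diff_distrib)
  then have "?ev (neg_lam_plus (del_act act) q) = base_act scale actM (c - a) (?ev q)" for q
    by (simp add: neg_lam_plus_def additive.minus[OF ev] M.base.scale_left_diff_distrib)
  then have "?ev (flip (del_act act) p)
      = M.eval (map_poly (\<lambda>x. ?ev (const1 x)) p) (c - a)"
    unfolding flip_def by (intro M.base.psubst_eval T ev) (simp_all add: const1_def)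
  also have "\<dots> = M.eval (\<beta> (eval p (c - a)) m) c"
    by (simp add: const1_def)
      (rule base.peval_map_poly; simp add: eval_left M.base.vector_space_axioms)
  finally show ?thesis .
qed

text \<open>By skewsymmetry \<open>[v\<^sub>a u]\<close> is minus the bracket of \<open>u\<close>
  and \<open>v\<close> at \<open>-a - \<partial>\<close>. Acting at \<open>a + b\<close>, this
  parameter becomes \<open>b\<close>, which leaves the given identity with \<open>a\<close> and
  \<open>b\<close> exchanged and the sign reversed.\<close>

lemma jacobi_on_sym:
  assumes "jacobi_on \<beta> u v"
  shows "jacobi_on \<beta> v u"
  unfolding jacobi_on_def
proof (intro allI)
  fix a b m
  have "M.eval (\<beta> (eval (bracket v u) a) m) (a + b)
      = - M.eval (\<beta> (eval (flip (del_act act) (bracket u v)) a) m) (a + b)"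
    by (simp add: L.skew[of v u] base.peval_minus additive.minus[OF eval_left(3)])
  also have "\<dots> = - M.eval (\<beta> (eval (bracket u v) b) m) (b + a)"
    by (simp add: eval_flip add.commute)
  finally show "M.eval (\<beta> v (M.eval (\<beta> u m) b)) a - M.eval (\<beta> u (M.eval (\<beta> v m) a)) b
      = M.eval (\<beta> (eval (bracket v u) a) m) (a + b)"
    using assms by (simp add: jacobi_on_def) (metis minus_diff_eq)
qed

end

section \<open>LCAd modules in terms of generators of the operator algebra\<close>

context algebroid_pair
begin

lemma lcad_module_iff:
  "lcad_module scale deriv act bracket anchor actM \<beta> \<longleftrightarrow>
    algebroid_action scale deriv act bracket anchor actM \<beta> \<and> (\<forall>u v. jacobi_on \<beta> u v)"
    (is "?L \<longleftrightarrow> ?R")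
proof
  assume ?L
  then interpret N: lcad_module scale deriv act bracket anchor actM \<beta> .
  have lin: "poly_linear (base_act scale actM) (base_act scale actM) (\<beta> u)"
    "poly_linear (base_act scale act) (base_act scale actM) (\<lambda>u. \<beta> u m)" for u m
    using N.lact_bilinear by (auto simp: poly_bilinear_def)
  have "\<forall>u v. jacobi_on \<beta> u v"
    using N.lact_bracket
    unfolding jacobi_on_def
      psubst2_eq_iff(2)[OF M.base.vector_space_axioms base.vector_space_axioms lin(1) lin(1) lin(2)]
    by blast
  moreover have "algebroid_action scale deriv act bracket anchor actM \<beta>"
  proof unfold_locales
    fix u f m
    show "\<beta> (fun_act act f u) m = M.fin.star f (\<beta> u m)"
      by (simp add: fun_act_def[of act] N.lact_act_left flip_const)
    have "additive (\<lambda>q. subst_left (fun_act actM) deriv q p)" for p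
      by (simp add: additive_def M.fin.subst_left_add_left)
    note minus = additive.minus[OF this]
    \<comment> \<open>The adjoint symbol of \<partial> is \<open>-\<lambda>\<close>.\<close>
    have "flip deriv [:0, 1:] = - pCons 0 [:1:]"
      by (simp add: flip_pCons flip_0 lam_plus_def map_poly_pCons)
    then show "\<beta> (del_act act u) m = - pCons 0 (\<beta> u m)"
      by (simp only: del_act_def N.lact_act_left minus M.fin.subst_left_lam M.star_1)
    show "\<beta> u (fun_act actM f m)
      = map_poly (fun_act actM f) (\<beta> u m) + map_poly (\<lambda>h. fun_act actM h m) (anchor u f)"
      by (simp add: fun_act_def[of actM f m] N.lact_act_right M.fin.subst_right_pCons
          M.fin.subst_right_0 M.fin.subst_arg_pCons M.fin.subst_arg_0)
    \<comment> \<open>The coefficients 0 and 1 of \<partial> are killed by the anchor, so only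
      \<open>\<lambda> + \<partial>\<close> survives in the right rule.\<close>
    have "map_poly (fun_act actM 1) p = p" for p
      by (rule poly_eqI) (simp add: coeff_map_poly)
    then show "\<beta> u (del_act actM m) = lam_plus (del_act actM) (\<beta> u m)"
      by (simp add: del_act_def[of actM m] N.lact_act_right M.fin.subst_right_pCons
          M.fin.subst_right_0 M.fin.subst_arg_pCons M.fin.subst_arg_0 M.fin.sm_0_fun map_poly_zero_fun)
  qed (rule N.lact_bilinear)
  ultimately show ?R by blast
next
  assume R: ?R
  then interpret N: algebroid_action scale deriv act bracket anchor actM \<beta> by blast
  show ?L
  proof unfold_locales
    fix u v m
    show "psubst2 mu (\<lambda>w. \<beta> w m) lam (bracket u v)
        = psubst2 lam (\<beta> u) mu_minus_lam (\<beta> v m) - psubst2 mu_minus_lam (\<beta> v) lam (\<beta> u m)"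
      unfolding psubst2_eq_iff(2)[OF M.base.vector_space_axioms base.vector_space_axioms
          N.linear_right N.linear_right N.linear_left]
      using R by (simp add: jacobi_on_def)
  qed (rule N.bilinear N.dop_left N.dop_right)+
qed

end

section \<open>Extension of a Poisson vertex algebra action to the differentials\<close>

text \<open>Cancellation can shrink the support of a sum, so all three sums are compared over the
  union of the supports, where the extra terms are values at 0.\<close>

lemma additive_sum_keys:
  fixes h :: "'a \<Rightarrow> 'b::ab_group_add \<Rightarrow> 'c::ab_group_add"
  assumes "\<And>g. additive (h g)"
  shows "additive (\<lambda>p. \<Sum>g\<in>Poly_Mapping.keys p. h g (Poly_Mapping.lookup p g))"
proof (rule additive.intro)
  fix p q :: "'a \<Rightarrow>\<^sub>0 'b"
  let ?K = "Poly_Mapping.keys p \<union> Poly_Mapping.keys q"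
  have ext: "(\<Sum>g\<in>Poly_Mapping.keys r. h g (Poly_Mapping.lookup r g))
      = (\<Sum>g\<in>?K. h g (Poly_Mapping.lookup r g))" if "Poly_Mapping.keys r \<subseteq> ?K" for r :: "'a \<Rightarrow>\<^sub>0 'b"
    using that by (intro sum.mono_neutral_left) (auto simp: in_keys_iff additive.zero[OF assms])
  show "(\<Sum>g\<in>Poly_Mapping.keys (p + q). h g (Poly_Mapping.lookup (p + q) g))
      = (\<Sum>g\<in>Poly_Mapping.keys p. h g (Poly_Mapping.lookup p g))
        + (\<Sum>g\<in>Poly_Mapping.keys q. h g (Poly_Mapping.lookup q g))"
    using keys_add[of p q]
    by (subst (1 2 3) ext) (auto simp: lookup_add additive.add[OF assms] sum.distrib)
qed

lemma lookup_free_scale: "Poly_Mapping.lookup (free_scale f p) g = f * Poly_Mapping.lookup p g"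
  by (simp add: free_scale_def Poly_Mapping.map.rep_eq when_def)

lemma module_free_scale: "module free_scale"
  by unfold_locales (auto intro!: poly_mapping_eqI simp: lookup_free_scale lookup_add algebra_simps)

section \<open>The presentation of the differentials\<close>

context kaehler_differentials
begin

text \<open>The canonical surjection from the free module, whose kernel is spanned by the
  relations.\<close>

definition present :: "('a \<Rightarrow>\<^sub>0 'a) \<Rightarrow> 'e" where
  "present p = (\<Sum>g\<in>Poly_Mapping.keys p. fun_act act (Poly_Mapping.lookup p g) (diff g))"

lemma additive_present: "additive present"
  unfolding present_def[abs_def] by (rule additive_sum_keys) (rule fin.additive_left)

lemma present_single: "present (Poly_Mapping.single g f) = fun_act act f (diff g)"
  by (simp add: present_def)

lemma present_relation: "p \<in> kaehler_relations scale \<Longrightarrow> present p = 0"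
  using presented module.span_base[OF module_free_scale] unfolding present_def by blast

lemmas present_simps =
  present_single additive.add[OF additive_present] additive.diff[OF additive_present]

lemma diff_add: "diff (g + h) = diff g + diff h"
proof -
  let ?p = "Poly_Mapping.single (g + h) 1 - Poly_Mapping.single g 1 - Poly_Mapping.single h (1 :: 'a)"
  have "?p \<in> kaehler_relations scale"
    unfolding kaehler_relations_def by blast
  from present_relation[OF this] show ?thesis
    by (simp add: present_simps algebra_simps)
qed

lemma diff_scale: "diff (scale c g) = base_act scale act c (diff g)"
proof -
  let ?p = "Poly_Mapping.single (scale c g) 1 - Poly_Mapping.single g (scale c 1)"
  have "?p \<in> kaehler_relations scale"
    unfolding kaehler_relations_def by blast
  from present_relation[OF this] show ?thesis
    by (simp add: present_simps base_act_def)
qed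

lemma diff_mult: "diff (f * g) = fun_act act f (diff g) + fun_act act g (diff f)"
proof -
  let ?p = "Poly_Mapping.single (f * g) 1 - Poly_Mapping.single g f - Poly_Mapping.single f g"
  have "?p \<in> kaehler_relations scale"
    unfolding kaehler_relations_def by blast
  from present_relation[OF this] show ?thesis
    by (simp add: present_simps algebra_simps)
qed

lemma diff_deriv: "diff (deriv g) = del_act act (diff g)"
  using del_fun_diff[of 1 g] by simp

text \<open>Elements are finite sums of terms \<open>f dg\<close>; zero is covered by taking
  \<open>f = 0\<close>.\<close>

lemma differential_induct [case_names fun_diff add]:
  assumes "\<And>f g. P (fun_act act f (diff g))" "\<And>u v. P u \<Longrightarrow> P v \<Longrightarrow> P (u + v)"
  shows "P u"
proof -
  obtain p where "u = present p"
    using generated unfolding surj_def present_def by blast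
  moreover have "P (\<Sum>g\<in>K. fun_act act (Poly_Mapping.lookup p g) (diff g))" if "finite K" for K
    using that
  proof induction
    case empty
    then show ?case using assms(1)[of 0] by simp
  qed (simp add: assms)
  ultimately show ?thesis by (simp add: present_def)
qed

end

section \<open>Restriction along \<open>d\<close> and extension to the differentials\<close>

locale kaehler_pair =
  kaehler_algebroid scale deriv bracketV act diff bracket anchor +
  algebroid_pair scale deriv act bracket anchor actM
  for scale :: "'k::field_char_0 \<Rightarrow> 'a::comm_ring_1 \<Rightarrow> 'a" and deriv
    and bracketV :: "'a \<Rightarrow> 'a \<Rightarrow> 'a poly"
    and act :: "'a poly \<Rightarrow> 'e::ab_group_add \<Rightarrow> 'e" and diff
    and bracket :: "'e \<Rightarrow> 'e \<Rightarrow> 'e poly"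
    and anchor :: "'e \<Rightarrow> 'a \<Rightarrow> 'a poly"
    and actM :: "'a poly \<Rightarrow> 'm::ab_group_add \<Rightarrow> 'm"
begin

lemma eval_bracket_diff: "eval (bracket (diff f) (diff g)) a = diff (peval scale (bracketV f g) a)"
  unfolding bracket_diff
  by (rule V.peval_map_poly) (simp_all add: additive_def diff_add diff_scale base.vector_space_axioms)

lemma bracket_jacobi_iff:
  assumes "\<And>u. poly_linear (base_act scale actM) (base_act scale actM) (\<alpha> u)"
    and "\<And>m. poly_linear scale (base_act scale actM) (\<lambda>u. \<alpha> u m)"
  shows "psubst2 lam (\<alpha> f) mu (\<alpha> g m) - psubst2 mu (\<alpha> g) lam (\<alpha> f m)
        = psubst2 lam_plus_mu (\<lambda>h. \<alpha> h m) lam (bracketV f g) \<longleftrightarrow>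
     (\<forall>a b. M.eval (\<alpha> f (M.eval (\<alpha> g m) b)) a - M.eval (\<alpha> g (M.eval (\<alpha> f m) a)) b
    = M.eval (\<alpha> (peval scale (bracketV f g) a) m) (a + b))"
  by (rule psubst2_eq_iff(1)[OF M.base.vector_space_axioms V.vector_space_axioms assms(1,1,2)])

text \<open>Left sesquilinearity comes from \<open>d \<partial> = \<partial> d\<close>, the left
  Leibniz rule from that of \<open>d\<close>, and the right one from the anchor of
  \<open>df\<close>. The Jacobi identities are matched at scalars.\<close>

lemma pva_module_restrict:
  assumes "lcad_module scale deriv act bracket anchor actM \<beta>"
  shows "pva_module scale deriv bracketV actM (\<lambda>f. \<beta> (diff f))"
proof -
  interpret algebroid_action scale deriv act bracket anchor actM \<beta>
    using assms lcad_module_iff by blast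
  have J: "jacobi_on \<beta> u v" for u v
    using assms lcad_module_iff by blast
  have lin: "poly_linear scale (base_act scale actM) (\<lambda>f. \<beta> (diff f) m)" for m
    by (rule poly_linearI)
      (simp_all add: V.vector_space_axioms M.base.vector_space_axioms diff_add diff_scale
        poly_linearD[OF linear_left])
  show ?thesis
  proof unfold_locales
    show "poly_bilinear scale (base_act scale actM) (base_act scale actM) (\<lambda>f. \<beta> (diff f))"
      by (simp add: poly_bilinear_def lin linear_right)
  next
    fix f g m
    show "\<beta> (diff (deriv f)) m = - pCons 0 (\<beta> (diff f) m)"
      by (simp only: diff_deriv del_left)
    show "\<beta> (diff f) (del_act actM m) = lam_plus (del_act actM) (\<beta> (diff f) m)"
      by (rule del_right)
    show "psubst2 lam (\<beta> (diff f)) mu (\<beta> (diff g) m) - psubst2 mu (\<beta> (diff g)) lam (\<beta> (diff f) m)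
        = psubst2 lam_plus_mu (\<lambda>h. \<beta> (diff h) m) lam (bracketV f g)"
      using J[of "diff f" "diff g"]
      by (subst bracket_jacobi_iff)
        (simp_all add: linear_right lin jacobi_on_def eval_bracket_diff)
    show "\<beta> (diff f) (fun_act actM g m)
        = map_poly (\<lambda>h. fun_act actM h m) (bracketV f g) + map_poly (fun_act actM g) (\<beta> (diff f) m)"
      by (simp add: fun_right anchor_diff)
    show "\<beta> (diff (f * g)) m = subst_left (fun_act actM) deriv [:f:] (\<beta> (diff g) m)
        + subst_left (fun_act actM) deriv [:g:] (\<beta> (diff f) m)"
      by (simp add: diff_mult add_left fun_left)
  qed
qed

text \<open>An arbitrary representative in the free module is chosen; \<open>lift_present\<close>
  shows that the choice is immaterial.\<close>

definition lift :: "('a \<Rightarrow> 'm \<Rightarrow> 'm poly) \<Rightarrow> 'e \<Rightarrow> 'm \<Rightarrow> 'm poly" where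
  "lift \<alpha> u m = (let p = (SOME p. present p = u)
    in \<Sum>g\<in>Poly_Mapping.keys p. M.fin.star (Poly_Mapping.lookup p g) (\<alpha> g m))"

context
  fixes \<alpha> :: "'a \<Rightarrow> 'm \<Rightarrow> 'm poly"
  assumes \<alpha>: "pva_module scale deriv bracketV actM \<alpha>"
begin

interpretation \<alpha>: pva_module scale deriv bracketV actM \<alpha>
  by (rule \<alpha>)

lemma pva_linear:
  "poly_linear (base_act scale actM) (base_act scale actM) (\<alpha> f)"
  "poly_linear scale (base_act scale actM) (\<lambda>f. \<alpha> f m)"
  using \<alpha>.lact_bilinear by (simp_all add: poly_bilinear_def)

text \<open>The formula defines an additive map \<open>F\<close> on the free module that turns
  multiplication by \<open>f\<close> into \<open>star f\<close>, so its kernel is a submodule. It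
  contains the relations, by linearity and the left Leibniz rule of \<alpha>, hence the kernel of
  \<open>present\<close>.\<close>

lemma lift_present:
  "lift \<alpha> (present p) m
    = (\<Sum>g\<in>Poly_Mapping.keys p. M.fin.star (Poly_Mapping.lookup p g) (\<alpha> g m))"
proof -
  define F where "F p = (\<Sum>g\<in>Poly_Mapping.keys p. M.fin.star (Poly_Mapping.lookup p g) (\<alpha> g m))" for p
  have F: "additive F"
    unfolding F_def[abs_def]
    by (rule additive_sum_keys) (simp add: additive_def M.fin.star_add_left)
  have single: "F (Poly_Mapping.single g f) = M.fin.star f (\<alpha> g m)" for f g
    by (simp add: F_def)
  have F_scale: "F (free_scale f p) = M.fin.star f (F p)" for f p
  proof -
    \<comment> \<open>Multiplication by \<open>f\<close> may annihilate coefficients and shrink the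
      support; the terms lost are zero.\<close>
    have "F (free_scale f p)
        = (\<Sum>g\<in>Poly_Mapping.keys p. M.fin.star (Poly_Mapping.lookup (free_scale f p) g) (\<alpha> g m))"
      unfolding F_def
      by (rule sum.mono_neutral_left) (auto simp: in_keys_iff lookup_free_scale)
    then show ?thesis
      by (simp add: F_def lookup_free_scale additive.sum[OF M.fin.additive_star] M.star_mult)
  qed
  interpret free: module free_scale by (rule module_free_scale)
  have "free.subspace {p. F p = 0}"
    by (rule free.subspaceI) (simp_all add: additive.zero[OF F] additive.add[OF F] F_scale)
  moreover have "kaehler_relations scale \<subseteq> {p. F p = 0}"
    by (auto simp: kaehler_relations_def single additive.diff[OF F] poly_linearD[OF pva_linear(2)]
        M.star_scale \<alpha>.lact_mult_left)
  ultimately have ker: "F p = 0" if "present p = 0" for p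
    using that presented[of p] free.span_minimal unfolding present_def by blast
  have "present (SOME q. present q = present p) = present p"
    by (rule someI) (rule refl)
  \<comment> \<open>Two representatives of one element differ by something in the kernel of
    \<open>present\<close>.\<close>
  then have "F (SOME q. present q = present p) = F p"
    using ker[of "(SOME q. present q = present p) - p"]
    by (simp add: additive.diff[OF F] additive.diff[OF additive_present])
  then show ?thesis by (simp add: lift_def F_def)
qed

lemma lift_fun_diff: "lift \<alpha> (fun_act act f (diff g)) m = M.fin.star f (\<alpha> g m)"
  using lift_present[of "Poly_Mapping.single g f" m] by (simp add: present_single)

lemma lift_diff: "lift \<alpha> (diff g) m = \<alpha> g m"
  using lift_fun_diff[of 1 g m] by simp

lemma lift_add: "lift \<alpha> (u + v) m = lift \<alpha> u m + lift \<alpha> v m"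
proof -
  obtain p q where "u = present p" "v = present q"
    using generated unfolding surj_def present_def by metis
  moreover have "additive (\<lambda>p. \<Sum>g\<in>Poly_Mapping.keys p. M.fin.star (Poly_Mapping.lookup p g) (\<alpha> g m))"
    by (rule additive_sum_keys) (simp add: additive_def M.fin.star_add_left)
  ultimately show ?thesis
    by (metis (no_types, lifting) additive.add additive_present lift_present)
qed

lemma lift_fun_left: "lift \<alpha> (fun_act act f u) m = M.fin.star f (lift \<alpha> u m)"
  by (induction u rule: differential_induct)
    (simp_all add: fun_act_mult lift_fun_diff M.star_mult lift_add fin.sm_add_right
      M.fin.subst_left_add_right)

lemma algebroid_action_lift: "algebroid_action scale deriv act bracket anchor actM (lift \<alpha>)"
proof unfold_locales
  have "lift \<alpha> (base_act scale act c u) m = map_poly (base_act scale actM c) (lift \<alpha> u m)" for c u m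
    by (simp add: base_act_def[of scale act] lift_fun_left M.star_scale)
  moreover have "lift \<alpha> u (m + n) = lift \<alpha> u m + lift \<alpha> u n" for u m n
    by (induction u rule: differential_induct)
      (simp_all add: lift_fun_diff lift_add poly_linearD[OF pva_linear(1)] M.fin.subst_left_add_right)
  moreover have "lift \<alpha> u (base_act scale actM c m) = map_poly (base_act scale actM c) (lift \<alpha> u m)"
    for c u m
    by (induction u rule: differential_induct)
      (simp_all add: lift_fun_diff lift_add poly_linearD[OF pva_linear(1)] M.fin.star_commute
        M.base.additive_scale M.fun_act_base map_poly_add)
  ultimately show "poly_bilinear (base_act scale act) (base_act scale actM) (base_act scale actM) (lift \<alpha>)"
    unfolding poly_bilinear_def
    by (intro conjI allI poly_linearI)
      (simp_all add: base.vector_space_axioms M.base.vector_space_axioms lift_add)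
next
  fix f u m
  show "lift \<alpha> (fun_act act f u) m = M.fin.star f (lift \<alpha> u m)"
    by (rule lift_fun_left)
  \<comment> \<open>On \<open>f dg\<close>, the summand \<open>\<partial>f dg\<close> cancels the
    correction that arises when \<open>star f\<close> passes the factor \<open>-\<lambda>\<close>
    given by \<open>\<partial>g\<close>.\<close>
  show "lift \<alpha> (del_act act u) m = - pCons 0 (lift \<alpha> u m)"
    by (induction u rule: differential_induct)
      (simp_all add: del_fun_diff lift_fun_diff lift_add additive.add[OF fin.D_add]
        \<alpha>.lact_deriv_left additive.minus[OF M.fin.additive_star] M.fin.star_lam del: minus_pCons,
       simp)
  show "lift \<alpha> u (fun_act actM f m) = map_poly (fun_act actM f) (lift \<alpha> u m)
      + map_poly (\<lambda>h. fun_act actM h m) (anchor u f)"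
    by (induction u rule: differential_induct)
      (simp_all add: lift_fun_diff lift_add \<alpha>.lact_fun_right M.fin.subst_left_add_right
        M.fin.star_commute M.fin.additive_right M.fun_act_mult mult.commute M.star_map_act
        anchor_fun_act anchor_diff anchor_add map_poly_add M.fin.additive_left algebra_simps)
  show "lift \<alpha> u (del_act actM m) = lam_plus (del_act actM) (lift \<alpha> u m)"
    by (induction u rule: differential_induct)
      (simp_all add: lift_fun_diff lift_add \<alpha>.lact_del_right M.fin.star_lam_plus
        additive.add[OF additive_lam_plus[OF M.fin.D_add]])
qed

lemma lcad_module_lift: "lcad_module scale deriv act bracket anchor actM (lift \<alpha>)"
proof -
  interpret algebroid_action scale deriv act bracket anchor actM "lift \<alpha>"
    by (rule algebroid_action_lift)
  have "jacobi_on (lift \<alpha>) (diff f) (diff g)" for f g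
    using \<alpha>.lact_bracket[unfolded bracket_jacobi_iff[OF pva_linear]]
    by (simp add: jacobi_on_def lift_diff eval_bracket_diff)
  then have "jacobi_on (lift \<alpha>) (diff f) u" for f u
    by (induction u rule: differential_induct) (simp_all add: jacobi_on_fun_act jacobi_on_add)
  \<comment> \<open>The extension step concerns the second argument, so the arguments are exchanged
    before it is used again.\<close>
  then have "jacobi_on (lift \<alpha>) u (diff f)" for f u
    by (rule jacobi_on_sym)
  then have "jacobi_on (lift \<alpha>) u v" for u v
    by (induction v rule: differential_induct) (simp_all add: jacobi_on_fun_act jacobi_on_add)
  then show ?thesis
    by (simp add: lcad_module_iff algebroid_action_axioms)
qed

end

text \<open>Both actions are additive in the acting element, and the rule for multiplying it by a
  function forces them to agree on each \<open>f dg\<close>.\<close>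

lemma lift_restrict:
  assumes "lcad_module scale deriv act bracket anchor actM \<beta>"
  shows "lift (\<lambda>f. \<beta> (diff f)) = \<beta>"
proof (intro ext)
  fix u m
  interpret algebroid_action scale deriv act bracket anchor actM \<beta>
    using assms lcad_module_iff by blast
  note \<alpha> = pva_module_restrict[OF assms]
  show "lift (\<lambda>f. \<beta> (diff f)) u m = \<beta> u m"
    by (induction u rule: differential_induct)
      (simp_all add: lift_fun_diff[OF \<alpha>] lift_add[OF \<alpha>] fun_left add_left)
qed

text \<open>Restriction along \<open>d\<close> is inverse to \<open>lift\<close>: one composite is
  settled by \<open>lift_diff\<close>, the other by \<open>lift_restrict\<close>.\<close>

lemma bij_betw_lift:
  "bij_betw lift {\<alpha>. pva_module scale deriv bracketV actM \<alpha>}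
    {\<beta>. lcad_module scale deriv act bracket anchor actM \<beta>}"
  by (rule bij_betw_byWitness[where f' = "\<lambda>\<beta> f. \<beta> (diff f)"])
    (auto intro!: ext simp: lift_diff lift_restrict lcad_module_lift pva_module_restrict)

end

theorem proposition4p9:
  fixes scale :: "'k::field_char_0 \<Rightarrow> 'v::comm_ring_1 \<Rightarrow> 'v"
    and deriv :: "'v \<Rightarrow> 'v"
    and pbr :: "'v \<Rightarrow> 'v \<Rightarrow> 'v poly"
    and act\<Omega> :: "'v poly \<Rightarrow> 'e::ab_group_add \<Rightarrow> 'e"
    and diff :: "'v \<Rightarrow> 'e"
    and bracket :: "'e \<Rightarrow> 'e \<Rightarrow> 'e poly"
    and anchor :: "'e \<Rightarrow> 'v \<Rightarrow> 'v poly"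
    and actM :: "'v poly \<Rightarrow> 'm::ab_group_add \<Rightarrow> 'm"
  assumes "poisson_vertex_algebra scale deriv pbr"
    and "kaehler_algebroid scale deriv pbr act\<Omega> diff bracket anchor"
    and "dop_module scale deriv actM"
  shows "\<exists>\<Phi>. bij_betw \<Phi>
      {\<alpha> :: 'v \<Rightarrow> 'm \<Rightarrow> 'm poly. pva_module scale deriv pbr actM \<alpha>}
      {\<beta> :: 'e \<Rightarrow> 'm \<Rightarrow> 'm poly. lcad_module scale deriv act\<Omega> bracket anchor actM \<beta>} \<and>
    (\<forall>\<alpha>. pva_module scale deriv pbr actM \<alpha> \<longrightarrow>
      (\<forall>f g m. \<Phi> \<alpha> (fun_act act\<Omega> f (diff g)) m
        = subst_left (fun_act actM) deriv [:f:] (\<alpha> g m)))"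
proof -
  interpret O: kaehler_algebroid scale deriv pbr act\<Omega> diff bracket anchor by fact
  interpret M: dop_module scale deriv actM by fact
  interpret kaehler_pair scale deriv pbr act\<Omega> diff bracket anchor actM ..
  show ?thesis
    using bij_betw_lift lift_fun_diff by blast
qed

end
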